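(* Let $G=\mathbb Z_3\times\mathbb Z_6$ and let $S(G)$ be its set of integer group determinants. (a) The odd elements $D\in S(G)$ with $3^7\parallel D$ are exactly the integers of the form $3^7(2m+1)p$ with $m\in\mathbb Z$ and $p$ a Type 1 prime (such that $3^7\parallel 3^7(2m+1)p$, i.e. $3\nmid 2m+1$). (b) The even elements $D\in S(G)$ with $3^7\parallel D$ are exactly the even integers $D$ with $3^7\parallel D$ that have one of the following forms (with $m,k\in\mathbb Z$): (1) $3^7\cdot 2^6 m$; (2) $3^7\cdot 2^4(2m+1)(7+18k)$; (3) $3^7\cdot 2^2 m(4+9k)p$, where $p$ is any Type 1 prime; (4) $3^7\cdot 2^2 m(2+9k)p$, where $p$ is a Type 1 prime with $p\equiv 7\pmod{18}$; (5) $3^7\cdot 2^2 m p$, where $p$ is a Type 1 prime with $p\equiv 13\pmod{18}$. In particular every even integer $D$ with $3^7\parallel D$ and $2^6\mid D$ lies in $S(G)$, and every even $D\in S(G)$ with $3^7\parallel D$ not of the forms (1) or (2) is divisible by a Type 1 prime.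
   Context: For a finite group $G$ and an element $\sum_{g\in G}a_g g\in\mathbb Z[G]$, its group determinant is $\det\left(a_{gh^{-1}}\right)_{g,h\in G}$; $S(G)$ is the set of all such values with integer $a_g$. $\mathbb Z_n$ is the cyclic group of order $n$. $3^7\parallel D$ means $3^7\mid D$ and $3^8\nmid D$. Let $\omega=e^{2\pi i/3}$ and $N(a+b\omega)=a^2-ab+b^2$. A prime $p$ is called a Type 1 prime if $p=N\big(2(1+3B)+3(1+2A)\omega\big)$ for some integers $A,B$ (equivalently, $p\equiv 1\pmod 3$ is a prime of the form $4x^2+2xy+7y^2$). *)

theory Defs
  imports "HOL-Analysis.Analysis" "HOL-Library.Numeral_Type"
    "HOL-Computational_Algebra.Primes" "HOL-Number_Theory.Cong"
begin

text \<open>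
  Finite groups are types of class \<^class>\<open>group_add\<close>, written additively, so that
  \<open>g - h\<close> is the element $g h^{-1}$.  An element $\sum_g a_g g$ of the integral group ring
  is given by its coefficient function \<open>a\<close>.
\<close>

definition group_determinant :: "('g::{finite,group_add} \<Rightarrow> int) \<Rightarrow> int" where
  "group_determinant a = det (\<chi> g h. a (g - h))"

definition integer_group_determinants :: "'g::{finite,group_add} itself \<Rightarrow> int set" where
  "integer_group_determinants _ = range (group_determinant :: ('g \<Rightarrow> int) \<Rightarrow> int)"

text \<open>
  The numeral types \<open>3\<close> and \<open>6\<close> carry arithmetic modulo 3 and modulo 6, and addition on
  pairs is componentwise; hence \<open>3 \<times> 6\<close> is the group $\mathbb{Z}_3 \times \mathbb{Z}_6$.
\<close>

abbreviation S_Z3_Z6 :: "int set" where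
  "S_Z3_Z6 \<equiv> integer_group_determinants TYPE(3 \<times> 6)"

definition exactly_divides :: "int \<Rightarrow> nat \<Rightarrow> int \<Rightarrow> bool" where
  "exactly_divides q k D \<longleftrightarrow> q ^ k dvd D \<and> \<not> q ^ Suc k dvd D"

text \<open>The norm $N(a + b\omega)$ with $\omega = e^{2\pi i/3}$.\<close>

definition eisenstein_norm :: "int \<Rightarrow> int \<Rightarrow> int" where
  "eisenstein_norm a b = a\<^sup>2 - a * b + b\<^sup>2"

definition type1_prime :: "int \<Rightarrow> bool" where
  "type1_prime p \<longleftrightarrow>
     prime p \<and> (\<exists>A B. p = eisenstein_norm (2 * (1 + 3 * B)) (3 * (1 + 2 * A)))"

definition form1 :: "int \<Rightarrow> bool" where
  "form1 D \<longleftrightarrow> (\<exists>m. D = 3 ^ 7 * 2 ^ 6 * m)"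

definition form2 :: "int \<Rightarrow> bool" where
  "form2 D \<longleftrightarrow> (\<exists>m k. D = 3 ^ 7 * 2 ^ 4 * (2 * m + 1) * (7 + 18 * k))"

definition form3 :: "int \<Rightarrow> bool" where
  "form3 D \<longleftrightarrow> (\<exists>m k p. type1_prime p \<and> D = 3 ^ 7 * 2\<^sup>2 * m * (4 + 9 * k) * p)"

definition form4 :: "int \<Rightarrow> bool" where
  "form4 D \<longleftrightarrow>
     (\<exists>m k p. type1_prime p \<and> [p = 7] (mod 18) \<and> D = 3 ^ 7 * 2\<^sup>2 * m * (2 + 9 * k) * p)"

definition form5 :: "int \<Rightarrow> bool" where
  "form5 D \<longleftrightarrow>
     (\<exists>m p. type1_prime p \<and> [p = 13] (mod 18) \<and> D = 3 ^ 7 * 2\<^sup>2 * m * p)"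

end

theory Submission
  imports Defs
begin

text \<open>
  Folding $\mathbb{Z}_6 = \mathbb{Z}_3 \times \mathbb{Z}_2$ along the sign character shows that
  $S(G)$ consists of the products $D(f) D(g)$ of two determinants for $\mathbb{Z}_3 \times \mathbb{Z}_3$
  with $f \equiv g$ modulo 2.  Each of these is the coefficient sum times four norms from
  $\mathbb{Z}[\omega]$, one for each direction of lines in $\mathbb{F}_3^2$.  If $3^7 \parallel D$, then
  one factor, say $D(g)$, is prime to 3, hence $D(g) \equiv \pm 1$ modulo 9, and $3^7 \parallel D(f)$.

  A type 1 prime is the norm of a primary integer of $\mathbb{Z}[\omega]$ not congruent to 1 modulo 2.
  If no type 1 prime divides $D$ and the norms are odd, then all values of $g$, suitably translated,
  are therefore 1 modulo 2, and hence so are those of $f$.  This determines the traces of the values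
  of $f$ modulo 9, and the relation between these traces forces the 3-adic valuation of $D(f)$ to be
  6 or at least 8.  The remaining conditions come from $D(g) \equiv \pm 1$ modulo 9 and the parities.
  Conversely, one explicit family of pairs $f, g$ realises all the values.
\<close>

section \<open>Factorisation of the group determinant\<close>

text \<open>The columns of the character table \<open>P\<close> are eigenvectors of
  \<open>M\<close>, and orthogonality makes \<open>P\<close> invertible. Characters are indexed by
  the group itself, so that all matrices are square of one type.\<close>

lemma group_determinant_eq_prod_characters:
  fixes a :: "'g::{finite,ab_group_add} \<Rightarrow> int" and \<psi> :: "'g \<Rightarrow> 'g \<Rightarrow> complex"
  assumes add: "\<And>u g h. \<psi> u (g + h) = \<psi> u g * \<psi> u h"
    and orth: "\<And>g. (\<Sum>u\<in>UNIV. \<psi> u g) = (if g = 0 then of_nat CARD('g) else 0)"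
  shows "of_int (group_determinant a) = (\<Prod>u\<in>UNIV. \<Sum>h\<in>UNIV. of_int (a h) * \<psi> u (- h))"
proof -
  define M :: "((complex, 'g) vec, 'g) vec" where "M = (\<chi> g h. of_int (a (g - h)))"
  define P :: "((complex, 'g) vec, 'g) vec" where "P = (\<chi> g u. \<psi> u g)"
  define Q :: "((complex, 'g) vec, 'g) vec" where "Q = (\<chi> u h. \<psi> u (- h))"
  define e where "e u = (\<Sum>h\<in>UNIV. of_int (a h) * \<psi> u (- h))" for u
  define E :: "((complex, 'g) vec, 'g) vec" where "E = (\<chi> u v. if u = v then e u else 0)"
  have "P ** Q = (\<chi> g h. if g = h then of_nat CARD('g) else 0)"
  proof -
    have "(\<Sum>u\<in>UNIV. \<psi> u g * \<psi> u (- h)) = (if g = h then of_nat CARD('g) else 0)" for g h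
      using orth[of "g - h"] add[of _ g "- h"] by simp
    then show ?thesis
      by (simp add: P_def Q_def matrix_matrix_mult_def vec_eq_iff)
  qed
  then have "det P * det Q = of_nat CARD('g) ^ CARD('g)"
    by (simp add: det_diagonal flip: det_mul)
  then have "det P \<noteq> 0"
    by auto
  have "M ** P = P ** E"
  proof -
    have "(\<Sum>h\<in>UNIV. of_int (a (g - h)) * \<psi> u h) = \<psi> u g * e u" for g u
    proof -
      have "(\<Sum>h\<in>UNIV. of_int (a (g - h)) * \<psi> u h) = (\<Sum>k\<in>UNIV. of_int (a k) * \<psi> u (g - k))"
        by (rule sum.reindex_bij_witness[of _ "\<lambda>k. g - k" "\<lambda>k. g - k"]) auto
      also have "\<dots> = (\<Sum>k\<in>UNIV. \<psi> u g * (of_int (a k) * \<psi> u (- k)))"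
        using add[of u g "- k" for k] by (intro sum.cong) auto
      finally show ?thesis
        by (simp add: e_def sum_distrib_left)
    qed
    then show ?thesis
      by (simp add: M_def P_def E_def matrix_matrix_mult_def vec_eq_iff if_distrib cong: if_cong)
  qed
  then have "det M * det P = det P * det E"
    by (metis det_mul)
  moreover have "det E = (\<Prod>u\<in>UNIV. e u)"
    by (simp add: E_def det_diagonal)
  moreover have "det M = of_int (group_determinant a)"
    by (simp add: M_def group_determinant_def det_def of_int_sum of_int_prod)
  ultimately show ?thesis
    using \<open>det P \<noteq> 0\<close> by (simp add: e_def)
qed

section \<open>Characters of the group Z_3 x Z_6\<close>

definition \<omega> :: complex where
  "\<omega> = Complex (- 1 / 2) (sqrt 3 / 2)"

lemma omega_sq: "\<omega> * \<omega> = - 1 - \<omega>"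
  by (simp add: \<omega>_def complex_eq_iff)

lemma omega_sq_left: "\<omega> * (\<omega> * z) = - z - \<omega> * z"
  by (simp add: omega_sq algebra_simps flip: mult.assoc)

text \<open>The generator 1 goes to 1 + \<omega>, a primitive sixth root of unity.\<close>

definition char6 :: "6 \<Rightarrow> complex" where
  "char6 x = (if x = 0 then 1 else if x = 1 then 1 + \<omega> else if x = 2 then \<omega>
     else if x = 3 then - 1 else if x = 4 then - 1 - \<omega> else - \<omega>)"

lemma UNIV_3_from_0: "(UNIV :: 3 set) = {0, 1, 2}"
  by (rule sym, rule card_subset_eq) simp_all

lemma UNIV_6: "(UNIV :: 6 set) = {0, 1, 2, 3, 4, 5}"
  by (rule sym, rule card_subset_eq) simp_all

lemma exhaust_3_from_0: "x = 0 \<or> x = 1 \<or> x = 2" for x :: 3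
  using UNIV_3_from_0 by blast

lemma exhaust_6: "x = 0 \<or> x = 1 \<or> x = 2 \<or> x = 3 \<or> x = 4 \<or> x = 5" for x :: 6
  using UNIV_6 by blast

lemma sum_UNIV_3: "(\<Sum>x\<in>UNIV. f x) = f 0 + f 1 + f 2" for f :: "3 \<Rightarrow> 'a::comm_monoid_add"
  unfolding UNIV_3_from_0 by (simp add: add.assoc)

lemma sum_UNIV_6: "(\<Sum>x\<in>UNIV. f x) = f 0 + f 1 + f 2 + f 3 + f 4 + f 5"
  for f :: "6 \<Rightarrow> 'a::comm_monoid_add"
  unfolding UNIV_6 by (simp add: add.assoc)

lemma prod_UNIV_3: "(\<Prod>x\<in>UNIV. f x) = f 0 * f 1 * f 2" for f :: "3 \<Rightarrow> 'a::comm_monoid_mult"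
  unfolding UNIV_3_from_0 by (simp add: mult.assoc)

lemma prod_UNIV_6: "(\<Prod>x\<in>UNIV. f x) = f 0 * f 1 * f 2 * f 3 * f 4 * f 5"
  for f :: "6 \<Rightarrow> 'a::comm_monoid_mult"
  unfolding UNIV_6 by (simp add: mult.assoc)

lemma sum_UNIV_prod: "(\<Sum>x\<in>UNIV. f x) = (\<Sum>i\<in>UNIV. \<Sum>j\<in>UNIV. f (i, j))"
  for f :: "'a::finite \<times> 'b::finite \<Rightarrow> 'c::comm_monoid_add"
  by (simp add: sum.cartesian_product)

lemma prod_UNIV_prod: "(\<Prod>x\<in>UNIV. f x) = (\<Prod>i\<in>UNIV. \<Prod>j\<in>UNIV. f (i, j))"
  for f :: "'a::finite \<times> 'b::finite \<Rightarrow> 'c::comm_monoid_mult"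
  by (simp add: prod.cartesian_product)

lemma numerals_mod_3: "(3 :: 3) = 0" "(4 :: 3) = 1" "(- 1 :: 3) = 2" "(- 2 :: 3) = 1"
  by simp_all

lemma char6_add: "char6 (x + y) = char6 x * char6 y"
  using exhaust_6[of x] exhaust_6[of y]
  by (elim disjE) (simp_all add: char6_def omega_sq algebra_simps)

lemma sum_char6: "(\<Sum>u\<in>UNIV. char6 (u * x)) = (if x = 0 then 6 else 0)"
  using exhaust_6[of x] by (elim disjE) (simp_all add: sum_UNIV_6 char6_def)

text \<open>Followed by \<open>char6\<close> this is the character of Z_3 that sends 1 to
  \<omega>.\<close>

definition embed3 :: "3 \<Rightarrow> 6" where
  "embed3 x = (if x = 0 then 0 else if x = 1 then 2 else 4)"

lemma embed3_add: "embed3 (x + y) = embed3 x + embed3 y"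
  using exhaust_3_from_0[of x] exhaust_3_from_0[of y]
  by (elim disjE) (simp_all add: embed3_def)

lemma sum_char6_embed3: "(\<Sum>u\<in>UNIV. char6 (embed3 (u * x))) = (if x = 0 then 3 else 0)"
  using exhaust_3_from_0[of x] by (elim disjE) (simp_all add: sum_UNIV_3 char6_def embed3_def)

definition pairing :: "3 \<times> 6 \<Rightarrow> 3 \<times> 6 \<Rightarrow> complex" where
  "pairing u h = char6 (embed3 (fst u * fst h) + snd u * snd h)"

lemma pairing_add: "pairing u (g + h) = pairing u g * pairing u h"
  unfolding pairing_def fst_add snd_add distrib_left embed3_add char6_add[symmetric]
  by (simp add: add_ac)

lemma sum_pairing:
  "(\<Sum>u\<in>UNIV. pairing u h) = (if h = 0 then of_nat CARD(3 \<times> 6) else 0)"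
proof -
  have "(\<Sum>u\<in>UNIV. pairing u h) =
    (\<Sum>u\<in>UNIV. char6 (embed3 (u * fst h))) * (\<Sum>u\<in>UNIV. char6 (u * snd h))"
    by (simp add: sum_UNIV_prod pairing_def sum_product char6_add)
  then show ?thesis
    by (simp add: sum_char6 sum_char6_embed3 prod_eq_iff card_prod)
qed

text \<open>The norm of the value A 0 + A 1 \<omega> + A 2 \<omega>^2, rewritten with \<omega>^2 =
  -1 - \<omega>.\<close>

definition line_norm :: "(3 \<Rightarrow> int) \<Rightarrow> int" where
  "line_norm A = eisenstein_norm (A 0 - A 2) (A 1 - A 2)"

definition total_sum :: "(3 \<Rightarrow> 3 \<Rightarrow> int) \<Rightarrow> int" where
  "total_sum f = (\<Sum>i\<in>UNIV. \<Sum>j\<in>UNIV. f i j)"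

text \<open>The sums of \<open>f\<close> along the lines of each of the four directions of the affine plane
  $\mathbb{F}_3^2$; each direction is the kernel of a pair of conjugate characters.\<close>

definition row_sum :: "(3 \<Rightarrow> 3 \<Rightarrow> int) \<Rightarrow> 3 \<Rightarrow> int" where
  "row_sum f r = (\<Sum>j\<in>UNIV. f r j)"

definition col_sum :: "(3 \<Rightarrow> 3 \<Rightarrow> int) \<Rightarrow> 3 \<Rightarrow> int" where
  "col_sum f r = (\<Sum>i\<in>UNIV. f i r)"

definition diag_sum :: "(3 \<Rightarrow> 3 \<Rightarrow> int) \<Rightarrow> 3 \<Rightarrow> int" where
  "diag_sum f r = (\<Sum>j\<in>UNIV. f (r + j) j)"

definition antidiag_sum :: "(3 \<Rightarrow> 3 \<Rightarrow> int) \<Rightarrow> 3 \<Rightarrow> int" where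
  "antidiag_sum f r = (\<Sum>j\<in>UNIV. f (r - j) j)"

definition det33 :: "(3 \<Rightarrow> 3 \<Rightarrow> int) \<Rightarrow> int" where
  "det33 f = total_sum f * line_norm (row_sum f) * line_norm (col_sum f) *
     line_norm (diag_sum f) * line_norm (antidiag_sum f)"

text \<open>\<open>even_part\<close> is the isomorphism of $\mathbb{Z}_3$ with the subgroup of order 3 of
  $\mathbb{Z}_6$ that is a section of reduction modulo 3.\<close>

definition even_part :: "3 \<Rightarrow> 6" where
  "even_part x = (if x = 0 then 0 else if x = 1 then 4 else 2)"

definition fold_plus :: "(3 \<times> 6 \<Rightarrow> int) \<Rightarrow> 3 \<Rightarrow> 3 \<Rightarrow> int" where
  "fold_plus a i j = a (i, even_part j) + a (i, even_part j + 3)"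

definition fold_minus :: "(3 \<times> 6 \<Rightarrow> int) \<Rightarrow> 3 \<Rightarrow> 3 \<Rightarrow> int" where
  "fold_minus a i j = a (i, even_part j) - a (i, even_part j + 3)"

lemmas line_sum_defs = row_sum_def col_sum_def diag_sum_def antidiag_sum_def

lemma eisenstein_norm_omega:
  "(of_int x + of_int y * \<omega>) * (of_int (x - y) - of_int y * \<omega>) = of_int (eisenstein_norm x y)"
  by (simp add: eisenstein_norm_def algebra_simps power2_eq_square omega_sq omega_sq_left)

lemma group_determinant_Z3_Z6:
  "group_determinant a = det33 (fold_plus a) * det33 (fold_minus a)"
proof -
  define e where "e p q = (\<Sum>h\<in>UNIV. of_int (a h) * pairing (p, q) (- h))" for p q
  have "of_int (group_determinant a) = (\<Prod>u\<in>UNIV. \<Sum>h\<in>UNIV. of_int (a h) * pairing u (- h))"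
    by (rule group_determinant_eq_prod_characters[OF pairing_add sum_pairing])
  also have "\<dots> = (\<Prod>p\<in>UNIV. \<Prod>q\<in>UNIV. e p q)"
    by (simp add: prod_UNIV_prod e_def)
  \<comment> \<open>Conjugate characters (p, q), (-p, -q) are paired. Those with even
    \<open>q\<close> are trivial on the element (0, 3) of order 2 and see only
    \<open>fold_plus a\<close>; those with odd \<open>q\<close> are -1 there and see only
    \<open>fold_minus a\<close>.\<close>
  also have "\<dots> = (e 0 0 * (e 2 0 * e 1 0) * (e 0 4 * e 0 2) * (e 2 2 * e 1 4) * (e 2 4 * e 1 2)) *
     (e 0 3 * (e 2 3 * e 1 3) * (e 0 1 * e 0 5) * (e 2 5 * e 1 1) * (e 2 1 * e 1 5))"
    by (simp add: prod_UNIV_3 prod_UNIV_6 mult_ac)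
  finally have prod: "of_int (group_determinant a) = \<dots>" .
  note e_simps = e_def sum_UNIV_prod sum_UNIV_3 sum_UNIV_6 pairing_def embed3_def
  note fold_simps = line_sum_defs fold_plus_def fold_minus_def even_part_def sum_UNIV_3
  have "(7 :: 6) = 1"
    by simp
  note wrap = this numerals_mod_3
  have total_values: "e 0 0 = of_int (total_sum (fold_plus a))" "e 0 3 = of_int (total_sum (fold_minus a))"
    by (simp_all add: e_simps char6_def total_sum_def fold_simps wrap)
  have line_norm: "e p q * e p' q' = of_int (line_norm A)"
    if "e p q = of_int (A 0 - A 2) + of_int (A 1 - A 2) * \<omega>"
      "e p' q' = of_int (A 0 - A 1) - of_int (A 1 - A 2) * \<omega>" for p q p' q' A
    using eisenstein_norm_omega[of "A 0 - A 2" "A 1 - A 2"] by (simp add: that line_norm_def)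
  have plus_values: "e 2 0 * e 1 0 = of_int (line_norm (row_sum (fold_plus a)))"
    "e 0 4 * e 0 2 = of_int (line_norm (col_sum (fold_plus a)))"
    "e 2 2 * e 1 4 = of_int (line_norm (diag_sum (fold_plus a)))"
    "e 2 4 * e 1 2 = of_int (line_norm (antidiag_sum (fold_plus a)))"
    by (rule line_norm; simp add: e_simps fold_simps wrap; simp add: char6_def algebra_simps)+
  have minus_values: "e 2 3 * e 1 3 = of_int (line_norm (row_sum (fold_minus a)))"
    "e 0 1 * e 0 5 = of_int (line_norm (col_sum (fold_minus a)))"
    "e 2 5 * e 1 1 = of_int (line_norm (diag_sum (fold_minus a)))"
    "e 2 1 * e 1 5 = of_int (line_norm (antidiag_sum (fold_minus a)))"
    by (rule line_norm; simp add: e_simps fold_simps wrap; simp add: char6_def algebra_simps)+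
  have "complex_of_int (group_determinant a) = of_int (det33 (fold_plus a) * det33 (fold_minus a))"
    unfolding prod by (simp only: total_values plus_values minus_values det33_def of_int_mult)
  then show ?thesis
    by (simp only: of_int_eq_iff)
qed

lemma S_Z3_Z6_eq:
  "S_Z3_Z6 = {det33 f * det33 g | f g. \<forall>i j. even (f i j - g i j)}"
proof (intro set_eqI iffI)
  fix D
  assume "D \<in> S_Z3_Z6"
  then obtain a :: "3 \<times> 6 \<Rightarrow> int" where "D = group_determinant a"
    by (auto simp: integer_group_determinants_def)
  then have "D = det33 (fold_plus a) * det33 (fold_minus a)"
    by (simp add: group_determinant_Z3_Z6)
  moreover have "\<forall>i j. even (fold_plus a i j - fold_minus a i j)"
    by (simp add: fold_plus_def fold_minus_def)
  ultimately show "D \<in> {det33 f * det33 g | f g. \<forall>i j. even (f i j - g i j)}"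
    by blast
next
  fix D
  assume "D \<in> {det33 f * det33 g | f g. \<forall>i j. even (f i j - g i j)}"
  then obtain f g where fg: "D = det33 f * det33 g" "\<forall>i j. even (f i j - g i j)"
    by blast
  \<comment> \<open>\<open>red\<close> is reduction modulo 3. The function \<open>a\<close> undoes
    the folding: half the sum on the subgroup of order 3, half the difference on its other coset,
    both integral by equal parity.\<close>
  define red :: "6 \<Rightarrow> 3" where
    "red x = (if x = 0 \<or> x = 3 then 0 else if x = 1 \<or> x = 4 then 1 else 2)" for x
  define a :: "3 \<times> 6 \<Rightarrow> int" where
    "a h = (case h of (i, k) \<Rightarrow>
       if k \<in> {0, 2, 4} then (f i (red k) + g i (red k)) div 2
       else (f i (red k) - g i (red k)) div 2)" for h
  have *: "even (x - y) \<Longrightarrow> (x + y) div 2 + (x - y) div 2 = x \<and> (x + y) div 2 - (x - y) div 2 = y"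
    for x y :: int
    by presburger
  have "fold_plus a i j = f i j \<and> fold_minus a i j = g i j" for i j
    using exhaust_3_from_0[of j] *[OF fg(2)[rule_format, of i j]]
    by (elim disjE) (simp_all add: fold_plus_def fold_minus_def even_part_def a_def red_def)
  then have "fold_plus a = f" "fold_minus a = g"
    by (auto intro!: ext)
  then have "D = group_determinant a"
    by (simp add: group_determinant_Z3_Z6 fg(1))
  then show "D \<in> S_Z3_Z6"
    by (auto simp: integer_group_determinants_def)
qed

section \<open>Norms of Eisenstein integers and type 1 primes\<close>

lemma eisenstein_norm_completed_square: "4 * eisenstein_norm x y = (2 * x - y)\<^sup>2 + 3 * y\<^sup>2"
  by (simp add: eisenstein_norm_def power2_eq_square algebra_simps)

lemma eisenstein_norm_nonneg: "0 \<le> eisenstein_norm x y"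
  using eisenstein_norm_completed_square[of x y] by (smt (verit) zero_le_power2)

lemma eisenstein_norm_eq_0_iff: "eisenstein_norm x y = 0 \<longleftrightarrow> x = 0 \<and> y = 0"
proof
  assume "eisenstein_norm x y = 0"
  then have "(2 * x - y)\<^sup>2 + 3 * y\<^sup>2 = 0"
    using eisenstein_norm_completed_square[of x y] by simp
  then have "y\<^sup>2 = 0 \<and> (2 * x - y)\<^sup>2 = 0"
    by (smt (verit) zero_le_power2)
  then show "x = 0 \<and> y = 0" by simp
qed (simp add: eisenstein_norm_def)

lemma eisenstein_norm_mult:
  "eisenstein_norm x y * eisenstein_norm u v = eisenstein_norm (x * u - y * v) (x * v + y * u - y * v)"
  by (simp add: eisenstein_norm_def power2_eq_square algebra_simps)

text \<open>On the right stands the product of x + y\<omega> with the conjugate of u +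
  v\<omega>.\<close>

lemma eisenstein_norm_mult_cnj:
  "eisenstein_norm x y * eisenstein_norm u v = eisenstein_norm (x * (u - v) + y * v) (y * u - x * v)"
  by (simp add: eisenstein_norm_def power2_eq_square algebra_simps)

lemma eisenstein_norm_scale: "eisenstein_norm (k * x) (k * y) = k\<^sup>2 * eisenstein_norm x y"
  by (simp add: eisenstein_norm_def power2_eq_square algebra_simps)

lemma eisenstein_norm_cnj: "eisenstein_norm (x - y) (- y) = eisenstein_norm x y"
  by (simp add: eisenstein_norm_def power2_eq_square algebra_simps)

lemma eisenstein_norm_uminus: "eisenstein_norm (- x) (- y) = eisenstein_norm x y"
  by (simp add: eisenstein_norm_def)

text \<open>Here and in the next lemma the element is multiplied by the units \<omega> and
  \<omega>^2.\<close>

lemma eisenstein_norm_omega1: "eisenstein_norm (- y) (x - y) = eisenstein_norm x y"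
  by (simp add: eisenstein_norm_def power2_eq_square algebra_simps)

lemma eisenstein_norm_omega2: "eisenstein_norm (y - x) (- x) = eisenstein_norm x y"
  by (simp add: eisenstein_norm_def power2_eq_square algebra_simps)

section \<open>Fermat descent: primes that are norms\<close>

lemma symmetric_residue:
  fixes n x :: int
  assumes "n > 0"
  obtains x' where "[x' = x] (mod n)" "2 * \<bar>x'\<bar> \<le> n"
proof (cases "2 * (x mod n) \<le> n")
  case True
  then show ?thesis
    using assms by (intro that[of "x mod n"]) (auto simp: cong_def)
next
  case False
  have "x mod n < n" using assms by simp
  with False show ?thesis
    by (intro that[of "x mod n - n"]) (auto simp: cong_def)
qed

text \<open>Coordinates of absolute value at most n/2 give a norm of at most 3n^2/4, so the cofactor
  drops below \<open>n\<close>.\<close>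

lemma eisenstein_norm_residue:
  fixes n x y :: int
  assumes "n > 0" "n dvd eisenstein_norm x y"
  obtains x' y' m where "[x' = x] (mod n)" "[y' = y] (mod n)"
    "eisenstein_norm x' y' = n * m" "0 \<le> m" "m < n"
proof -
  obtain x' where x': "[x' = x] (mod n)" "2 * \<bar>x'\<bar> \<le> n" using symmetric_residue assms(1) by blast
  obtain y' where y': "[y' = y] (mod n)" "2 * \<bar>y'\<bar> \<le> n" using symmetric_residue assms(1) by blast
  have "[eisenstein_norm x' y' = eisenstein_norm x y] (mod n)"
    unfolding eisenstein_norm_def using x'(1) y'(1) by (intro cong_add cong_diff cong_mult cong_pow)
  then have "n dvd eisenstein_norm x' y'"
    using assms(2) by (simp add: cong_dvd_iff)
  then obtain m where m: "eisenstein_norm x' y' = n * m" by blast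
  have "x'\<^sup>2 * 4 \<le> n\<^sup>2" "y'\<^sup>2 * 4 \<le> n\<^sup>2" 
    using x'(2) y'(2) assms(1) power_mono[of "2 * \<bar>x'\<bar>" n 2] power_mono[of "2 * \<bar>y'\<bar>" n 2]
    by (auto simp: power_mult_distrib)
  moreover have "4 * \<bar>x' * y'\<bar> \<le> n\<^sup>2"
    using mult_mono[OF x'(2) y'(2)] assms(1) by (simp add: abs_mult power2_eq_square)
  ultimately have "4 * (n * m) \<le> 3 * n\<^sup>2"
    unfolding m[symmetric] eisenstein_norm_def right_diff_distrib distrib_left by linarith
  then have "n * (4 * m) \<le> n * (3 * n)" by (simp add: power2_eq_square)
  then have "4 * m \<le> 3 * n" using assms(1) by simp
  moreover have "0 \<le> m"
    using m eisenstein_norm_nonneg[of x' y'] assms(1) by (simp add: zero_le_mult_iff)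
  ultimately show ?thesis
    using that[OF x'(1) y'(1) m] assms(1) by linarith
qed

text \<open>Descent on the cofactor \<open>n\<close>: multiplying the element by the conjugate of
  its reduction modulo \<open>n\<close> and dividing by \<open>n\<close> leaves norm m q with m <
  n.\<close>

lemma prime_eisenstein_norm_descent:
  fixes q :: int
  assumes "prime q" "0 < n" "n < q" "eisenstein_norm x y = n * q"
  shows "\<exists>u v. q = eisenstein_norm u v"
  using assms(2-)
proof (induction "nat n" arbitrary: n x y rule: less_induct)
  case less
  show ?case
  proof (cases "n = 1")
    case True
    with less.prems show ?thesis by auto
  next
    case False
    obtain x' y' m where xy: "[x' = x] (mod n)" "[y' = y] (mod n)"
      "eisenstein_norm x' y' = n * m" "0 \<le> m" "m < n"
      using eisenstein_norm_residue[of n x y] less.prems by auto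
    have "m \<noteq> 0"
    proof
      assume "m = 0"
      with xy have "x' = 0" "y' = 0" by (auto simp: eisenstein_norm_eq_0_iff)
      with xy(1,2) have "n dvd x" "n dvd y" by (auto simp: cong_0_iff cong_sym_eq[of 0])
      then obtain x1 y1 where "x = n * x1" "y = n * y1" by (auto elim!: dvdE)
      with less.prems have "n * (n * eisenstein_norm x1 y1) = n * q"
        by (simp add: eisenstein_norm_scale power2_eq_square mult.assoc)
      with less.prems have "n dvd q" by (metis dvd_triv_left mult_cancel_left less_irrefl)
      with \<open>prime q\<close> less.prems False show False
        by (metis prime_int_iff less_irrefl less_imp_le)
    qed
    \<comment> \<open>Modulo \<open>n\<close> the product is the element times its own conjugate,
      that is n q, with \<omega>-coordinate 0.\<close>
    have "[x * (x' - y') + y * y' = x * (x - y) + y * y] (mod n)"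
      using xy by (intro cong_add cong_diff cong_mult) auto
    also have "x * (x - y) + y * y = n * q"
      using less.prems by (simp add: eisenstein_norm_def power2_eq_square algebra_simps)
    finally have "n dvd x * (x' - y') + y * y'" by (simp add: cong_dvd_iff)
    moreover have "[y * x' - x * y' = y * x - x * y] (mod n)"
      using xy by (intro cong_diff cong_mult) auto
    then have "n dvd y * x' - x * y'" by (simp add: cong_0_iff mult.commute)
    ultimately obtain u v where uv: "x * (x' - y') + y * y' = n * u" "y * x' - x * y' = n * v"
      by (auto elim!: dvdE)
    have "n\<^sup>2 * eisenstein_norm u v = (n * q) * (n * m)"
      using eisenstein_norm_mult_cnj[of x y x' y'] less.prems xy uv
      by (simp add: eisenstein_norm_scale)
    then have "eisenstein_norm u v = m * q"
      using less.prems by (simp add: power2_eq_square)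
    with less.hyps[of m u v] \<open>m \<noteq> 0\<close> xy less.prems show ?thesis by auto
  qed
qed

text \<open>One reduction modulo \<open>q\<close> brings the cofactor below \<open>q\<close>, where
  the descent starts; the last assumption excludes cofactor 0.\<close>

lemma prime_eq_eisenstein_norm:
  fixes q :: int
  assumes "prime q" "q dvd eisenstein_norm x y" "\<not> q dvd y"
  shows "\<exists>u v. q = eisenstein_norm u v"
proof -
  have "q > 0" using assms(1) by (simp add: prime_gt_0_int)
  then obtain x' y' m where xy: "[x' = x] (mod q)" "[y' = y] (mod q)"
    "eisenstein_norm x' y' = q * m" "0 \<le> m" "m < q"
    using eisenstein_norm_residue[of q x y] assms by auto
  have "y' \<noteq> 0"
    using xy(2) assms(3) by (auto simp: cong_0_iff cong_sym_eq[of 0])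
  then have "m \<noteq> 0"
    using xy(3) by (auto simp: eisenstein_norm_eq_0_iff)
  with xy prime_eisenstein_norm_descent[OF assms(1), of m x' y'] show ?thesis
    by (simp add: mult.commute)
qed

lemma prime_dvd_eisenstein_norm_fst:
  fixes q :: int
  assumes "prime q" "q dvd eisenstein_norm x y" "q dvd y"
  shows "q dvd x"
proof -
  have "eisenstein_norm x y = x\<^sup>2 + y * (y - x)"
    by (simp add: eisenstein_norm_def power2_eq_square algebra_simps)
  then have "q dvd x\<^sup>2" using assms by (simp add: dvd_add_left_iff)
  then show ?thesis using assms(1) prime_dvd_power by blast
qed

text \<open>One of the associates by powers of \<omega> is congruent to a rational integer modulo
  3.\<close>

lemma eisenstein_norm_primary:
  assumes "\<not> 3 dvd eisenstein_norm u v"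
  obtains u' v' where "eisenstein_norm u' v' = eisenstein_norm u v" "3 dvd v'" "\<not> 3 dvd u'"
proof -
  have eq: "eisenstein_norm u v = (u + v)\<^sup>2 - 3 * (u * v)"
    by (simp add: eisenstein_norm_def power2_eq_square algebra_simps)
  have "\<not> 3 dvd u + v"
  proof
    assume "3 dvd u + v"
    then have "3 dvd (u + v)\<^sup>2" by (simp add: power2_eq_square)
    with assms show False unfolding eq by simp
  qed
  then have "3 dvd v \<and> \<not> 3 dvd u \<or> 3 dvd u - v \<and> \<not> 3 dvd v \<or> 3 dvd u \<and> \<not> 3 dvd v - u"
    by presburger
  then consider "3 dvd v" "\<not> 3 dvd u" | "3 dvd u - v" "\<not> 3 dvd v" | "3 dvd u" "\<not> 3 dvd v - u"
    by blast
  then show ?thesis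
  proof cases
    case 1 then show ?thesis by (intro that[of u v]) auto
  next
    case 2 then show ?thesis by (intro that[of "- v" "u - v"]) (auto simp: eisenstein_norm_omega1)
  next
    case 3 then show ?thesis by (intro that[of "v - u" "- u"]) (auto simp: eisenstein_norm_omega2)
  qed
qed

text \<open>The definition wants a first coordinate that is even and 2 modulo 3. Conjugation
  replaces an odd \<open>u\<close> by the even u - v, and a sign change corrects the residue modulo
  3.\<close>

lemma type1_primeI:
  assumes "prime (eisenstein_norm u v)" "3 dvd v" "\<not> 3 dvd u" "odd v"
  shows "type1_prime (eisenstein_norm u v)"
proof -
  have even_case: "type1_prime p"
    if p: "prime p" "p = eisenstein_norm u v" "3 dvd v" "\<not> 3 dvd u" "odd v" "even u" for p u v
  proof -
    have "\<exists>A. v = 3 * (1 + 2 * A)" using p(3,5) by presburger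
    then obtain A where A: "v = 3 * (1 + 2 * A)" by blast
    have "u mod 3 = 1 \<or> u mod 3 = 2" using p(4) by presburger
    then show ?thesis
    proof
      assume "u mod 3 = 1"
      with p(6) have "\<exists>B. - u = 2 * (1 + 3 * B)" by presburger
      moreover have "- v = 3 * (1 + 2 * (- 1 - A))" using A by simp
      ultimately show ?thesis
        unfolding type1_prime_def using p(1,2) eisenstein_norm_uminus by metis
    next
      assume "u mod 3 = 2"
      with p(6) have "\<exists>B. u = 2 * (1 + 3 * B)" by presburger
      then show ?thesis
        unfolding type1_prime_def using p(1,2) A by metis
    qed
  qed
  show ?thesis
  proof (cases "even u")
    case True
    then show ?thesis using even_case assms by blast
  next
    case False
    then show ?thesis
      using even_case[of _ "u - v" "- v"] assms by (simp add: eisenstein_norm_cnj dvd_diff_left_iff)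
  qed
qed

lemma odd_eisenstein_norm: "odd (eisenstein_norm x y) \<longleftrightarrow> odd x \<or> odd y"
  by (auto simp: eisenstein_norm_def)

lemma three_dvd_eisenstein_norm: "3 dvd eisenstein_norm x y \<longleftrightarrow> 3 dvd x + y"
proof -
  have "eisenstein_norm x y = (x + y)\<^sup>2 - 3 * (x * y)"
    by (simp add: eisenstein_norm_def power2_eq_square algebra_simps)
  moreover have "3 dvd (x + y)\<^sup>2 \<longleftrightarrow> 3 dvd x + y"
    by (rule prime_dvd_power_iff) auto
  ultimately show ?thesis by (simp add: dvd_diff_left_iff)
qed

text \<open>Modulo 2 the primary integers with \<open>y\<close> even form a multiplicative class, so some
  prime factor of an odd primary integer outside this class is itself outside it.\<close>

lemma type1_prime_dvd_eisenstein_norm: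
  assumes "3 dvd y" "\<not> 3 dvd x" "odd y"
  shows "\<exists>p. type1_prime p \<and> p dvd eisenstein_norm x y"
  using assms
proof (induction "nat (eisenstein_norm x y)" arbitrary: x y rule: less_induct)
  case less
  let ?N = "eisenstein_norm x y"
  have "?N \<noteq> 1"
  proof
    assume "?N = 1"
    then have "3 * y\<^sup>2 \<le> 4"
      using eisenstein_norm_completed_square[of x y] by (smt (verit) zero_le_power2)
    moreover have "\<bar>y\<bar> \<ge> 3" using less.prems by presburger
    then have "3\<^sup>2 \<le> y\<^sup>2" using power_mono[of 3 "\<bar>y\<bar>" 2] by simp
    ultimately show False by simp
  qed
  then have "\<not> is_unit ?N" using eisenstein_norm_nonneg[of x y] by auto
  moreover have "?N \<noteq> 0" using less.prems by (auto simp: eisenstein_norm_eq_0_iff)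
  ultimately obtain q where q: "prime q" "q dvd ?N" using prime_divisor_exists by blast
  have N: "?N > 0" using \<open>?N \<noteq> 0\<close> eisenstein_norm_nonneg[of x y] by simp
  have "\<not> 3 dvd ?N" using less.prems by (simp add: three_dvd_eisenstein_norm dvd_add_left_iff)
  with q have q3: "\<not> 3 dvd q" using dvd_trans by blast
  have "odd ?N" using less.prems by (simp add: odd_eisenstein_norm)
  with q have "odd q" using dvd_trans by blast
  have "q > 1" using q prime_gt_1_int by blast
  \<comment> \<open>The induction step: it suffices to split off a factor greater than 1 from the
    norm and stay in the class of primary integers with odd \<omega>-coordinate.\<close>
  have descend: "\<exists>p. type1_prime p \<and> p dvd ?N"
    if "?N = k * eisenstein_norm x1 y1" "k > 1" "3 dvd y1" "\<not> 3 dvd x1" "odd y1" for k x1 y1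
  proof -
    have "eisenstein_norm x1 y1 > 0"
      using N that(1,2) by (simp add: zero_less_mult_iff)
    then have "eisenstein_norm x1 y1 < ?N" using that(1,2) by simp
    then have "nat (eisenstein_norm x1 y1) < nat ?N"
      using N by simp
    then show ?thesis using less.hyps[of x1 y1] that by auto
  qed
  show ?case
  proof (cases "q dvd y")
    case True
    then have "q dvd x" using prime_dvd_eisenstein_norm_fst q by blast
    with True obtain x1 y1 where xy: "x = q * x1" "y = q * y1" by (auto elim!: dvdE)
    have "3 dvd y1"
      using less.prems xy q3 prime_dvd_mult_iff[of 3 q y1] by auto
    moreover have "1 < q\<^sup>2" using \<open>q > 1\<close> by (simp add: one_less_power)
    ultimately show ?thesis
      using less.prems xy by (intro descend[of "q\<^sup>2" x1 y1]) (auto simp: eisenstein_norm_scale)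
  next
    case False
    then obtain u0 v0 where "q = eisenstein_norm u0 v0" using prime_eq_eisenstein_norm q by blast
    then obtain u v where uv: "q = eisenstein_norm u v" "3 dvd v" "\<not> 3 dvd u"
      using eisenstein_norm_primary q3 by metis
    show ?thesis
    proof (cases "odd v")
      case True
      then show ?thesis using type1_primeI uv q by metis
    next
      case False
      then have "odd u" using uv(1) \<open>odd q\<close> by (simp add: odd_eisenstein_norm)
      \<comment> \<open>\<open>X\<close> and \<open>Y\<close> will be the coordinates of x +
        y\<omega> times u + v\<omega> or its conjugate. Dividing such a product by \<open>q\<close>
        amounts to dividing x + y\<omega> by a prime above \<open>q\<close>.\<close>
      have quotient: "\<exists>p. type1_prime p \<and> p dvd ?N"
        if XY: "eisenstein_norm X Y = ?N * q" "q dvd Y" "3 dvd Y" "\<not> 3 dvd X" "odd Y" for X Y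
      proof -
        have "q dvd X" using prime_dvd_eisenstein_norm_fst[of q X Y] q XY by simp
        then obtain X1 Y1 where XY1: "X = q * X1" "Y = q * Y1" using XY(2) by (auto elim!: dvdE)
        have "?N = q * eisenstein_norm X1 Y1"
          using XY(1) \<open>q > 1\<close> unfolding XY1 eisenstein_norm_scale
          by (simp add: power2_eq_square mult_ac)
        moreover have "3 dvd Y1" using XY XY1 q3 prime_dvd_mult_iff[of 3 q Y1] by auto
        ultimately show ?thesis
          using XY XY1 \<open>q > 1\<close> by (intro descend[of q X1 Y1]) auto
      qed
      have mod3: "\<not> 3 dvd x * u"
        using less.prems uv prime_dvd_mult_iff[of 3 x u] by auto
      \<comment> \<open>Up to sign the factors are the \<omega>-coordinates of the products with the
        conjugate of u + v\<omega> and with u + v\<omega> itself; \<open>q\<close> divides one of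
        them.\<close>
      have "(x * v - y * u) * (x * v + y * u - y * v) = ?N * v\<^sup>2 - q * y\<^sup>2"
        unfolding uv(1) by (simp add: eisenstein_norm_def power2_eq_square algebra_simps)
      then have "q dvd (x * v - y * u) * (x * v + y * u - y * v)"
        using q by simp
      then consider "q dvd x * v - y * u" | "q dvd x * v + y * u - y * v"
        using q prime_dvd_mult_iff by blast
      then show ?thesis
      proof cases
        case 1
        then have "q dvd y * u - x * v" by (simp add: dvd_diff_commute)
        moreover have "\<not> 3 dvd x * (u - v) + y * v"
          using mod3 uv less.prems by (simp add: algebra_simps dvd_add_left_iff dvd_diff_left_iff)
        ultimately show ?thesis
          using less.prems uv False \<open>odd u\<close>
          by (intro quotient[of "x * (u - v) + y * v" "y * u - x * v"])
            (auto simp: eisenstein_norm_mult_cnj)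
      next
        case 2
        moreover have "\<not> 3 dvd x * u - y * v"
          using mod3 uv less.prems by (simp add: dvd_diff_left_iff)
        ultimately show ?thesis
          using less.prems uv False \<open>odd u\<close>
          by (intro quotient[of "x * u - y * v" "x * v + y * u - y * v"])
            (auto simp: eisenstein_norm_mult)
      qed
    qed
  qed
qed

section \<open>Norms without type 1 prime factors\<close>

definition type1_free :: "int \<Rightarrow> bool" where
  "type1_free n \<longleftrightarrow> (\<forall>p. type1_prime p \<longrightarrow> \<not> p dvd n)"

lemma type1_free_dvd: "type1_free n \<Longrightarrow> m dvd n \<Longrightarrow> type1_free m"
  by (auto simp: type1_free_def dest: dvd_trans)

lemma type1_free_even:
  assumes "type1_free (eisenstein_norm x y)" "3 dvd y" "\<not> 3 dvd x"
  shows "even y"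
  using assms type1_prime_dvd_eisenstein_norm type1_free_def by blast

text \<open>If another associate were the primary one, its \<omega>-coordinate, -x or x - y, would
  be odd, against \<open>type1_free_even\<close>.\<close>

lemma type1_free_primary:
  assumes "type1_free (eisenstein_norm x y)" "odd x" "even y" "\<not> 3 dvd x + y"
  shows "3 dvd y"
proof (rule ccontr)
  assume "\<not> 3 dvd y"
  with assms(4) have "3 dvd x \<and> \<not> 3 dvd y - x \<or> 3 dvd x - y \<and> \<not> 3 dvd - y"
    by presburger
  then consider "3 dvd x" "\<not> 3 dvd y - x" | "3 dvd x - y" "\<not> 3 dvd - y"
    by blast
  then show False
  proof cases
    case 1
    then show False
      using type1_free_even[of "y - x" "- x"] assms by (simp add: eisenstein_norm_omega2)
  next
    case 2
    then show False
      using type1_free_even[of "- y" "x - y"] assms by (simp add: eisenstein_norm_omega1)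
  qed
qed

text \<open>Here \<open>2 * x - y\<close> is the trace of \<open>x + y\<omega>\<close>.\<close>

lemma type1_free_trace_1:
  assumes "type1_free (eisenstein_norm x y)" "odd x" "even y" "3 dvd x + y" "\<not> 3 dvd y"
  shows "9 dvd 2 * x - y"
proof -
  obtain k where k: "x + y = 3 * k" using assms(4) by blast
  \<comment> \<open>This factors x + y\<omega> as 1 + 2\<omega>, of norm 3, times c + d\<omega>. The
    trace becomes -3d, and c + d\<omega> turns out to be primary.\<close>
  define c d where "c = 2 * k - x" and "d = k - x"
  then have cd: "x = c - 2 * d" "y = 2 * c - d"
    using k by simp_all
  have norm: "eisenstein_norm x y = 3 * eisenstein_norm c d"
    by (simp add: cd eisenstein_norm_def power2_eq_square algebra_simps)
  have "odd c" "even d" using assms(2,3) cd by auto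
  moreover have "\<not> 3 dvd c + d" using assms(5) cd by presburger
  ultimately have "3 dvd d"
    using type1_free_primary[of c d] type1_free_dvd[OF assms(1)] norm by simp
  then show ?thesis using cd by presburger
qed

text \<open>Division by 3 leaves c + d\<omega> of norm prime to 3, which must be primary; the trace
  is 3(2c - d), where 3 divides d but not c.\<close>

lemma type1_free_trace_2:
  assumes "type1_free (eisenstein_norm x y)" "odd x" "even y" "3 dvd x" "3 dvd y"
    "\<not> 27 dvd eisenstein_norm x y"
  shows "\<not> 9 dvd 2 * x - y"
proof -
  from assms(4,5) obtain c d where cd: "x = 3 * c" "y = 3 * d" by (auto elim!: dvdE)
  have norm: "eisenstein_norm x y = 9 * eisenstein_norm c d"
    by (simp add: cd eisenstein_norm_scale)
  then have "\<not> 3 dvd c + d"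
    using assms(6) by (auto simp flip: three_dvd_eisenstein_norm)
  moreover have "odd c" "even d" using assms(2,3) cd by auto
  ultimately have "3 dvd d"
    using type1_free_primary[of c d] type1_free_dvd[OF assms(1)] norm by simp
  then show ?thesis using cd \<open>\<not> 3 dvd c + d\<close> by presburger
qed

text \<open>After division by 3 the trace 2c - d is 2(c + d) modulo 3, and 3 divides the norm just
  when it divides c + d.\<close>

lemma trace_3:
  assumes "3 dvd x" "3 dvd y" "27 dvd eisenstein_norm x y"
  shows "9 dvd 2 * x - y"
proof -
  from assms(1,2) obtain c d where cd: "x = 3 * c" "y = 3 * d" by (auto elim!: dvdE)
  then have "9 * 3 dvd 9 * eisenstein_norm c d"
    using assms(3) by (simp add: eisenstein_norm_scale)
  then have "3 dvd eisenstein_norm c d"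
    by (subst (asm) dvd_mult_cancel_left) simp
  then have "3 dvd c + d" by (simp add: three_dvd_eisenstein_norm)
  then show ?thesis using cd by presburger
qed

section \<open>Congruences for determinants over the group of order 9\<close>

text \<open>The \<omega>-coordinate of the value in \<open>line_norm A\<close>. Modulo 3 it is the
  first moment of \<open>A\<close>, since 2 is -1.\<close>

abbreviation slope :: "(3 \<Rightarrow> int) \<Rightarrow> int" where
  "slope A \<equiv> A 1 - A 2"

lemmas line_sum_simps = line_sum_defs total_sum_def sum_UNIV_3 numerals_mod_3

lemma line_sums:
  "row_sum f 0 + row_sum f 1 + row_sum f 2 = total_sum f"
  "col_sum f 0 + col_sum f 1 + col_sum f 2 = total_sum f"
  "diag_sum f 0 + diag_sum f 1 + diag_sum f 2 = total_sum f"
  "antidiag_sum f 0 + antidiag_sum f 1 + antidiag_sum f 2 = total_sum f"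
  by (simp_all add: line_sum_simps)

text \<open>The four lines through a point cover the plane, the point itself four times.\<close>

lemma lines_through_0:
  "row_sum f 0 + col_sum f 0 + diag_sum f 0 + antidiag_sum f 0 = total_sum f + 3 * f 0 0"
  by (simp add: line_sum_simps)

text \<open>Modulo 3 slopes are first moments, and the diagonals are indexed by i - j. The
  antidiagonals below are indexed by i + j.\<close>

lemma slope_diags: "[slope (diag_sum f) = slope (row_sum f) - slope (col_sum f)] (mod 3)"
proof -
  have "slope (diag_sum f) - (slope (row_sum f) - slope (col_sum f)) = 3 * (f 2 1 - f 1 2)"
    by (simp add: line_sum_simps)
  then show ?thesis
    by (simp add: cong_iff_dvd_diff)
qed

lemma slope_antidiags: "[slope (antidiag_sum f) = slope (row_sum f) + slope (col_sum f)] (mod 3)"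
proof -
  have "slope (antidiag_sum f) - (slope (row_sum f) + slope (col_sum f)) = 3 * (f 2 2 - f 1 1)"
    by (simp add: line_sum_simps)
  then show ?thesis
    by (simp add: cong_iff_dvd_diff)
qed

section \<open>Translations of the plane\<close>

definition shift :: "3 \<Rightarrow> 3 \<Rightarrow> (3 \<Rightarrow> 3 \<Rightarrow> int) \<Rightarrow> 3 \<Rightarrow> 3 \<Rightarrow> int" where
  "shift h k f i j = f (i + h) (j + k)"

lemma sum_UNIV_3_shift: "(\<Sum>x\<in>UNIV. F (x + k)) = (\<Sum>x\<in>UNIV. F x)"
  for k :: 3 and F :: "3 \<Rightarrow> 'a::comm_monoid_add"
  by (rule sum.reindex_bij_witness[of _ "\<lambda>x. x - k" "\<lambda>x. x + k"]) auto

lemma total_sum_shift: "total_sum (shift h k f) = total_sum f"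
  using sum_UNIV_3_shift[of "\<lambda>i. \<Sum>j\<in>UNIV. f i j" h]
  by (simp add: total_sum_def shift_def sum_UNIV_3_shift[of "f _"])

lemma row_sum_shift: "row_sum (shift h k f) = (\<lambda>r. row_sum f (r + h))"
  by (rule ext) (simp add: row_sum_def shift_def sum_UNIV_3_shift[of "f (_ + h)"])

lemma col_sum_shift: "col_sum (shift h k f) = (\<lambda>r. col_sum f (r + k))"
  by (rule ext) (simp add: col_sum_def shift_def sum_UNIV_3_shift[of "\<lambda>i. f i (_ + k)"])

lemma diag_sum_shift: "diag_sum (shift h k f) = (\<lambda>r. diag_sum f (r + (h - k)))"
proof
  fix r
  show "diag_sum (shift h k f) r = diag_sum f (r + (h - k))"
    using sum_UNIV_3_shift[of "\<lambda>j. f (r + (h - k) + j) j" k]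
    by (simp add: diag_sum_def shift_def algebra_simps)
qed

lemma antidiag_sum_shift: "antidiag_sum (shift h k f) = (\<lambda>r. antidiag_sum f (r + (h + k)))"
proof
  fix r
  show "antidiag_sum (shift h k f) r = antidiag_sum f (r + (h + k))"
    using sum_UNIV_3_shift[of "\<lambda>j. f (r + (h + k) - j) j" k]
    by (simp add: antidiag_sum_def shift_def algebra_simps)
qed

text \<open>Translating the index multiplies the value by a power of \<omega>.\<close>

lemma line_norm_shift: "line_norm (\<lambda>r. A (r + k)) = line_norm A"
  using exhaust_3_from_0[of k]
  by (elim disjE)
    (simp_all add: line_norm_def eisenstein_norm_def power2_eq_square algebra_simps numerals_mod_3)

lemmas line_norms_shift =
  row_sum_shift col_sum_shift diag_sum_shift antidiag_sum_shift line_norm_shift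

lemma det33_shift: "det33 (shift h k f) = det33 f"
  by (simp add: det33_def total_sum_shift line_norms_shift)

lemma slope_shift_primary:
  assumes "\<not> 3 dvd A 0 + A 1 + A 2"
  shows "\<exists>k. 3 dvd slope (\<lambda>r. A (r + k))"
proof -
  have "3 dvd A 1 - A 2 \<or> 3 dvd A 2 - A 0 \<or> 3 dvd A 0 - A 1"
    using assms by presburger
  moreover have "slope (\<lambda>r. A (r + 0)) = A 1 - A 2" "slope (\<lambda>r. A (r + 1)) = A 2 - A 0"
    "slope (\<lambda>r. A (r + 2)) = A 0 - A 1"
    by (simp_all add: numerals_mod_3)
  ultimately show ?thesis by metis
qed

text \<open>The two components of a translation act separately on rows and columns; the slope
  congruences then settle both diagonal directions.\<close>

lemma shift_primary:
  assumes "\<not> 3 dvd total_sum g"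
  obtains h k where "3 dvd slope (row_sum (shift h k g))" "3 dvd slope (col_sum (shift h k g))"
    "3 dvd slope (diag_sum (shift h k g))" "3 dvd slope (antidiag_sum (shift h k g))"
proof -
  obtain h where "3 dvd slope (\<lambda>r. row_sum g (r + h))"
    using slope_shift_primary[of "row_sum g"] assms by (auto simp: line_sums)
  moreover obtain k where "3 dvd slope (\<lambda>r. col_sum g (r + k))"
    using slope_shift_primary[of "col_sum g"] assms by (auto simp: line_sums)
  ultimately have *: "3 dvd slope (row_sum (shift h k g))" "3 dvd slope (col_sum (shift h k g))"
    by (simp_all add: row_sum_shift col_sum_shift)
  then have "3 dvd slope (diag_sum (shift h k g))" "3 dvd slope (antidiag_sum (shift h k g))"
    using cong_dvd_iff[OF slope_diags[of "shift h k g"]]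
      cong_dvd_iff[OF slope_antidiags[of "shift h k g"]] by (simp_all only: dvd_diff dvd_add)
  with * show ?thesis using that by blast
qed

text \<open>Expressed through \<open>A 0\<close> and \<open>s\<close>, because
  \<open>lines_through_0\<close> supplies the sum of the four numbers \<open>A 0\<close>.\<close>

lemma line_norm_mod_9:
  assumes "A 0 + A 1 + A 2 = s" "3 dvd slope A"
  shows "[line_norm A = s * (3 * A 0 - 2 * s)] (mod 9)"
proof -
  obtain t where t: "A 1 = A 2 + 3 * t"
    using assms(2) by (metis add.commute diff_add_cancel dvdE)
  have "line_norm A - s * (3 * A 0 - 2 * s) = 9 * ((A 2)\<^sup>2 + 3 * A 2 * t + 3 * t\<^sup>2)"
    unfolding assms(1)[symmetric] line_norm_def eisenstein_norm_def t power2_eq_square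
    by (simp add: algebra_simps)
  then show ?thesis
    by (simp add: cong_iff_dvd_diff)
qed

text \<open>Modulo 9 the product of the four norms is linear in the line sums through the origin,
  whose total is known. What remains is s^9, and the ninth power of a unit modulo 9 is 1 or
  -1.\<close>

lemma det33_mod_9:
  assumes "\<not> 3 dvd total_sum g"
  shows "[det33 g = 1] (mod 9) \<or> [det33 g = - 1] (mod 9)"
proof -
  obtain h k where hk: "3 dvd slope (row_sum (shift h k g))" "3 dvd slope (col_sum (shift h k g))"
    "3 dvd slope (diag_sum (shift h k g))" "3 dvd slope (antidiag_sum (shift h k g))"
    using shift_primary assms by blast
  define f where "f = shift h k g"
  define s where "s = total_sum f"
  define a b c d where "a = row_sum f 0" and "b = col_sum f 0" and "c = diag_sum f 0" and "d = antidiag_sum f 0"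
  have "[det33 f = s * (s * (3 * a - 2 * s)) * (s * (3 * b - 2 * s)) *
      (s * (3 * c - 2 * s)) * (s * (3 * d - 2 * s))] (mod 9)"
    unfolding det33_def a_def b_def c_def d_def s_def
    using hk by (intro cong_mult line_norm_mod_9) (simp_all add: line_sums f_def)
  also have "s * (s * (3 * a - 2 * s)) * (s * (3 * b - 2 * s)) *
      (s * (3 * c - 2 * s)) * (s * (3 * d - 2 * s)) =
      s ^ 5 * (16 * s ^ 4 - 24 * s ^ 3 * (a + b + c + d)) + 9 * (s ^ 5 * (
        4 * s\<^sup>2 * (a * b + a * c + a * d + b * c + b * d + c * d) -
        6 * s * (a * b * c + a * b * d + a * c * d + b * c * d) + 9 * (a * b * c * d)))"
    by algebra
  also have "[\<dots> = s ^ 5 * (16 * s ^ 4 - 24 * s ^ 3 * (a + b + c + d))] (mod 9)"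
    by (simp add: cong_iff_dvd_diff)
  also have "a + b + c + d = s + 3 * f 0 0"
    using lines_through_0[of f] by (simp add: a_def b_def c_def d_def s_def)
  also have "s ^ 5 * (16 * s ^ 4 - 24 * s ^ 3 * (s + 3 * f 0 0)) =
      s ^ 9 - 9 * (s ^ 9 + 8 * s ^ 8 * f 0 0)"
    by algebra
  also have "[\<dots> = s ^ 9] (mod 9)"
    by (simp add: cong_iff_dvd_diff)
  finally have "[det33 g = s ^ 9] (mod 9)"
    by (simp add: f_def det33_shift)
  moreover have "[s ^ 9 = 1] (mod 9) \<or> [s ^ 9 = - 1] (mod 9)"
  proof -
    have "\<not> 3 dvd s" using assms by (simp add: s_def f_def total_sum_shift)
    then have "s mod 9 \<in> {1, 2, 4, 5, 7, 8}" by (simp, presburger)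
    then have "(s mod 9) ^ 9 mod 9 = 1 \<or> (s mod 9) ^ 9 mod 9 = 8" by auto
    then show ?thesis by (auto simp: cong_def power_mod)
  qed
  ultimately show ?thesis using cong_trans by blast
qed

lemma three_dvd_line_norm:
  assumes "A 0 + A 1 + A 2 = s"
  shows "3 dvd line_norm A \<longleftrightarrow> 3 dvd s"
proof -
  \<comment> \<open>Modulo 1 + 2\<omega> one has \<omega> = 1, so the value reduces to the total
    \<open>s\<close>.\<close>
  have *: "A 0 - A 2 + (A 1 - A 2) = s - 3 * A 2" using assms by simp
  show ?thesis
    unfolding line_norm_def three_dvd_eisenstein_norm * by (simp add: dvd_diff_left_iff)
qed

lemma three_dvd_det33: "3 dvd det33 f \<longleftrightarrow> 3 dvd total_sum f"
proof -
  have "prime (3 :: int)" by simp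
  then show ?thesis
    by (simp add: det33_def prime_dvd_mult_iff three_dvd_line_norm[OF line_sums(1)]
        three_dvd_line_norm[OF line_sums(2)] three_dvd_line_norm[OF line_sums(3)]
        three_dvd_line_norm[OF line_sums(4)])
qed

lemma det33_dvd_if_three_dvd_total:
  assumes "3 dvd total_sum f"
  shows "3 ^ 5 dvd det33 f"
proof -
  have "3 * 3 * 3 * 3 * 3 dvd det33 f"
    unfolding det33_def using assms
    by (intro mult_dvd_mono) (simp_all add: three_dvd_line_norm[OF line_sums(1)]
        three_dvd_line_norm[OF line_sums(2)] three_dvd_line_norm[OF line_sums(3)]
        three_dvd_line_norm[OF line_sums(4)])
  then show ?thesis by simp
qed

lemma nine_dvd_line_norm:
  assumes "A 0 + A 1 + A 2 = s" "3 dvd s" "3 dvd slope A"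
  shows "3 dvd A 0 - A 2" "9 dvd line_norm A"
proof -
  show "3 dvd A 0 - A 2" using assms by presburger
  with assms(3) obtain x y where "A 0 - A 2 = 3 * x" "slope A = 3 * y" by (auto elim!: dvdE)
  then show "9 dvd line_norm A" by (simp add: line_norm_def eisenstein_norm_scale)
qed

text \<open>When 3 divides the coordinate sum of x + y\<omega>, the norm is 3y^2 modulo 9.\<close>

lemma not_nine_dvd_line_norm:
  assumes "A 0 + A 1 + A 2 = s" "3 dvd s" "\<not> 3 dvd slope A"
  shows "\<not> 9 dvd line_norm A"
proof
  assume "9 dvd line_norm A"
  moreover have "3 dvd A 0 - A 2 + slope A" using assms(1,2) by presburger
  then obtain r where "A 0 - A 2 + slope A = 3 * r" by blast
  then have r: "A 0 - A 2 = 3 * r - slope A" by simp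
  have "line_norm A = 9 * (r\<^sup>2 - r * slope A) + 3 * (slope A)\<^sup>2"
    unfolding line_norm_def eisenstein_norm_def r power2_eq_square by (simp add: algebra_simps)
  ultimately have "9 dvd 3 * (slope A)\<^sup>2" by (simp add: dvd_add_right_iff)
  then have "3 * 3 dvd 3 * (slope A)\<^sup>2" by simp
  then have "3 dvd (slope A)\<^sup>2" by (subst (asm) dvd_mult_cancel_left) simp
  then have "3 dvd slope A" by (rule prime_dvd_power[rotated]) simp
  with assms(3) show False ..
qed

text \<open>The traces \<open>3 * A 0 - s\<close> of the four values add up to \<open>- s\<close> modulo 9. Without type 1
  primes the first three vanish modulo 9, which makes the 3-adic valuation 6 or at least 8.\<close>

lemma type1_free_valuation:
  fixes A B C E :: "3 \<Rightarrow> int"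
  assumes sums: "A 0 + A 1 + A 2 = s" "B 0 + B 1 + B 2 = s" "C 0 + C 1 + C 2 = s" "E 0 + E 1 + E 2 = s"
    and "3 dvd s" and point: "A 0 + B 0 + C 0 + E 0 = s + 3 * z"
    and odd: "odd (A 0 - A 2)" "odd (B 0 - B 2)" "odd (C 0 - C 2)" "odd (E 0 - E 2)"
    and even: "even (slope A)" "even (slope B)" "even (slope C)" "even (slope E)"
    and free: "type1_free (line_norm A)" "type1_free (line_norm B)" "type1_free (line_norm C)"
      "type1_free (line_norm E)"
    and slopes: "\<not> 3 dvd slope A" "\<not> 3 dvd slope B" "\<not> 3 dvd slope C" "3 dvd slope E"
  shows "\<not> exactly_divides 3 7 (s * line_norm A * line_norm B * line_norm C * line_norm E)"
proof -
  have trace: "9 dvd 3 * F 0 - s"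
    if "F 0 + F 1 + F 2 = s" "odd (F 0 - F 2)" "even (slope F)" "type1_free (line_norm F)"
      "\<not> 3 dvd slope F" for F :: "3 \<Rightarrow> int"
  proof -
    have "3 dvd F 0 - F 2 + slope F" using that(1) \<open>3 dvd s\<close> by presburger
    then have "9 dvd 2 * (F 0 - F 2) - slope F"
      using type1_free_trace_1 that unfolding line_norm_def by blast
    also have "2 * (F 0 - F 2) - slope F = 3 * F 0 - s" using that(1) by simp
    finally show ?thesis .
  qed
  have "9 dvd 3 * A 0 - s" "9 dvd 3 * B 0 - s" "9 dvd 3 * C 0 - s"
    using trace sums odd even free slopes by blast+
  then have E: "9 dvd 3 * E 0 - s \<longleftrightarrow> 9 dvd s"
    using point by presburger
  have E_trace: "2 * (E 0 - E 2) - slope E = 3 * E 0 - s" using sums(4) by simp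
  have norms: "\<exists>n. line_norm F = 3 * n \<and> \<not> 3 dvd n"
    if "F 0 + F 1 + F 2 = s" "\<not> 3 dvd slope F" for F :: "3 \<Rightarrow> int"
  proof -
    have "3 dvd line_norm F"
      using three_dvd_line_norm[of F s] that(1) \<open>3 dvd s\<close> by simp
    then obtain n where n: "line_norm F = 3 * n" by blast
    moreover have "\<not> 3 dvd n"
      using not_nine_dvd_line_norm[of F s] that \<open>3 dvd s\<close> n by auto
    ultimately show ?thesis by blast
  qed
  obtain a b c where abc: "line_norm A = 3 * a" "line_norm B = 3 * b" "line_norm C = 3 * c"
    "\<not> 3 dvd a" "\<not> 3 dvd b" "\<not> 3 dvd c"
    using norms[of A] norms[of B] norms[of C] sums slopes by blast
  have x: "3 dvd E 0 - E 2" "9 dvd line_norm E"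
    using nine_dvd_line_norm sums(4) \<open>3 dvd s\<close> slopes(4) by blast+
  obtain s' e where se: "s = 3 * s'" "line_norm E = 9 * e" using \<open>3 dvd s\<close> x(2) by (auto elim!: dvdE)
  have prod: "s * line_norm A * line_norm B * line_norm C * line_norm E = 3 ^ 6 * (s' * a * b * c * e)"
    by (simp add: se abc)
  show ?thesis
  \<comment> \<open>If 27 does not divide the norm, the valuations add up to 1 + 3 + 2 = 6;
    otherwise they add up to at least 2 + 3 + 3 = 8.\<close>
  proof (cases "27 dvd line_norm E")
    case False
    then have "\<not> 9 dvd 3 * E 0 - s"
      using type1_free_trace_2[of "E 0 - E 2" "slope E"] free(4) odd(4) even(4) x slopes(4)
      unfolding line_norm_def E_trace by blast
    then have "\<not> 9 dvd s" using E by blast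
    then have "\<not> 3 dvd s'" "\<not> 3 dvd e" using se False by auto
    then have "\<not> 3 dvd s' * a * b * c * e" using abc by (simp add: prime_dvd_mult_iff)
    then have "\<not> 3 ^ 6 * 3 dvd 3 ^ 6 * (s' * a * b * c * e)"
      by (subst dvd_mult_cancel_left) simp
    then show ?thesis unfolding exactly_divides_def prod by simp
  next
    case True
    then have "9 dvd 3 * E 0 - s"
      using trace_3[of "E 0 - E 2" "slope E"] x slopes(4)
      unfolding line_norm_def E_trace by blast
    then have "9 dvd s" using E by blast
    then have "3 dvd s'" "3 dvd e" using se True by auto
    then have "3 * 3 dvd s' * e" by (rule mult_dvd_mono)
    then have "3 * 3 dvd s' * a * b * c * e"
      by (metis dvd_mult2 mult.assoc mult.commute)
    then have "3 ^ 6 * (3 * 3) dvd 3 ^ 6 * (s' * a * b * c * e)" by (rule mult_dvd_mono[OF dvd_refl])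
    then show ?thesis unfolding exactly_divides_def prod by simp
  qed
qed

text \<open>The slopes modulo 3 are the linear forms r, c, r - c, r + c on F_3^2. Either all vanish,
  and 3^9 divides the determinant, or exactly one does, and its direction plays the role of
  \<open>E\<close> in \<open>type1_free_valuation\<close>.\<close>

lemma type1_free_det33_valuation:
  assumes "3 dvd total_sum f"
    and odd: "odd (row_sum f 0 - row_sum f 2)" "odd (col_sum f 0 - col_sum f 2)"
      "odd (diag_sum f 0 - diag_sum f 2)" "odd (antidiag_sum f 0 - antidiag_sum f 2)"
    and even: "even (slope (row_sum f))" "even (slope (col_sum f))"
      "even (slope (diag_sum f))" "even (slope (antidiag_sum f))"
    and "type1_free (det33 f)"
  shows "\<not> exactly_divides 3 7 (det33 f)"
proof -
  have free: "type1_free (line_norm (row_sum f))" "type1_free (line_norm (col_sum f))"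
    "type1_free (line_norm (diag_sum f))" "type1_free (line_norm (antidiag_sum f))"
    by (rule type1_free_dvd[OF assms(10)]; simp add: det33_def)+
  note rule = type1_free_valuation[where s = "total_sum f" and z = "f 0 0"]
  let ?R = "3 dvd slope (row_sum f)" and ?C = "3 dvd slope (col_sum f)"
    and ?D = "3 dvd slope (diag_sum f)" and ?A = "3 dvd slope (antidiag_sum f)"
  have "?R \<and> ?C \<and> ?D \<and> ?A \<or> ?R \<and> \<not> ?C \<and> \<not> ?D \<and> \<not> ?A \<or> \<not> ?R \<and> ?C \<and> \<not> ?D \<and> \<not> ?A \<or>
    \<not> ?R \<and> \<not> ?C \<and> ?D \<and> \<not> ?A \<or> \<not> ?R \<and> \<not> ?C \<and> \<not> ?D \<and> ?A"
  proof -
    have "3 dvd r \<and> 3 dvd c \<and> 3 dvd r - c \<and> 3 dvd r + c \<or>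
      3 dvd r \<and> \<not> 3 dvd c \<and> \<not> 3 dvd r - c \<and> \<not> 3 dvd r + c \<or>
      \<not> 3 dvd r \<and> 3 dvd c \<and> \<not> 3 dvd r - c \<and> \<not> 3 dvd r + c \<or>
      \<not> 3 dvd r \<and> \<not> 3 dvd c \<and> 3 dvd r - c \<and> \<not> 3 dvd r + c \<or>
      \<not> 3 dvd r \<and> \<not> 3 dvd c \<and> \<not> 3 dvd r - c \<and> 3 dvd r + c" for r c :: int
      by presburger
    then show ?thesis
      by (simp only: cong_dvd_iff[OF slope_diags[of f]] cong_dvd_iff[OF slope_antidiags[of f]])
  qed
  then show ?thesis
  proof (elim disjE conjE)
    assume "?R" "?C" "?D" "?A"
    then have "3 * 9 * 9 * 9 * 9 dvd det33 f"
      unfolding det33_def using assms(1)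
      by (intro mult_dvd_mono nine_dvd_line_norm[OF line_sums(1)]
          nine_dvd_line_norm[OF line_sums(2)] nine_dvd_line_norm[OF line_sums(3)]
          nine_dvd_line_norm[OF line_sums(4)])
    then have "3 ^ 8 dvd det33 f" by (rule dvd_trans[rotated]) simp
    then show ?thesis by (simp add: exactly_divides_def)
  next
    assume "?R" "\<not> ?C" "\<not> ?D" "\<not> ?A"
    then show ?thesis
      using rule[of "col_sum f" "diag_sum f" "antidiag_sum f" "row_sum f"] line_sums[of f] lines_through_0[of f]
        assms(1) odd even free
      by (simp add: det33_def ac_simps)
  next
    assume "\<not> ?R" "?C" "\<not> ?D" "\<not> ?A"
    then show ?thesis
      using rule[of "row_sum f" "diag_sum f" "antidiag_sum f" "col_sum f"] line_sums[of f] lines_through_0[of f]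
        assms(1) odd even free
      by (simp add: det33_def ac_simps)
  next
    assume "\<not> ?R" "\<not> ?C" "?D" "\<not> ?A"
    then show ?thesis
      using rule[of "row_sum f" "col_sum f" "antidiag_sum f" "diag_sum f"] line_sums[of f] lines_through_0[of f]
        assms(1) odd even free
      by (simp add: det33_def ac_simps)
  next
    assume "\<not> ?R" "\<not> ?C" "\<not> ?D" "?A"
    then show ?thesis
      using rule[of "row_sum f" "col_sum f" "diag_sum f" "antidiag_sum f"] line_sums[of f] lines_through_0[of f]
        assms(1) odd even free
      by (simp add: det33_def ac_simps)
  qed
qed

section \<open>Transfer of parities between the two factors\<close>

abbreviation same_parity :: "(3 \<Rightarrow> 3 \<Rightarrow> int) \<Rightarrow> (3 \<Rightarrow> 3 \<Rightarrow> int) \<Rightarrow> bool" where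
  "same_parity f g \<equiv> \<forall>i j. even (f i j - g i j)"

lemma same_parity_line_sums:
  assumes "same_parity f g"
  shows "even (row_sum f r - row_sum g r)" "even (col_sum f r - col_sum g r)"
    "even (diag_sum f r - diag_sum g r)" "even (antidiag_sum f r - antidiag_sum g r)" "even (total_sum f - total_sum g)"
  unfolding line_sum_defs total_sum_def sum_subtractf[symmetric]
  using assms by (auto intro!: dvd_sum)

lemma same_parity_even_line_norm:
  assumes "\<And>r. even (A r - B r)"
  shows "even (line_norm A) \<longleftrightarrow> even (line_norm B)"
  using assms[of 0] assms[of 1] assms[of 2] by (simp add: line_norm_def eisenstein_norm_def)

lemma type1_prime_dvd_det33:
  assumes "same_parity f g" "3 dvd total_sum f" "\<not> 3 dvd total_sum g" "exactly_divides 3 7 (det33 f)"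
    and odd: "odd (line_norm (row_sum g))" "odd (line_norm (col_sum g))"
      "odd (line_norm (diag_sum g))" "odd (line_norm (antidiag_sum g))"
  shows "\<exists>p. type1_prime p \<and> p dvd det33 f * det33 g"
proof (rule ccontr)
  assume "\<not> ?thesis"
  then have free: "type1_free (det33 f * det33 g)" by (simp add: type1_free_def)
  obtain h k where hk: "3 dvd slope (row_sum (shift h k g))" "3 dvd slope (col_sum (shift h k g))"
    "3 dvd slope (diag_sum (shift h k g))" "3 dvd slope (antidiag_sum (shift h k g))"
    using shift_primary assms(3) by blast
  \<comment> \<open>The translation that makes the values of \<open>g\<close> primary is applied to
    \<open>f\<close> as well; this preserves the matching parities and both determinants.\<close>
  define F G where "F = shift h k f" and "G = shift h k g"
  have par: "same_parity F G" using assms(1) by (simp add: F_def G_def shift_def)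
  \<comment> \<open>\<open>Y\<close> stands for line sums of \<open>G\<close>, \<open>X\<close> for
    those of \<open>F\<close>: the primary value of \<open>Y\<close> is 1 modulo 2, and equal parity
    passes this on to \<open>X\<close>.\<close>
  have cls: "odd (X 0 - X 2) \<and> even (slope X)"
    if "3 dvd slope Y" "Y 0 + Y 1 + Y 2 = total_sum G" "odd (line_norm Y)" "line_norm Y dvd det33 G"
      "\<And>r. even (X r - Y r)" for X Y
  proof -
    have "\<not> 3 dvd total_sum G" using assms(3) by (simp add: G_def total_sum_shift)
    then have "\<not> 3 dvd Y 0 - Y 2" using that(1,2) by presburger
    moreover have "type1_free (line_norm Y)"
      using free that(4) by (auto intro: type1_free_dvd simp: G_def det33_shift)
    ultimately have "even (slope Y)"
      using type1_free_even that(1) unfolding line_norm_def by blast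
    moreover from this have "odd (Y 0 - Y 2)"
      using that(3) by (simp add: line_norm_def odd_eisenstein_norm)
    ultimately show ?thesis using that(5)[of 0] that(5)[of 1] that(5)[of 2] by presburger
  qed
  have "odd (line_norm (row_sum G))" "odd (line_norm (col_sum G))"
    "odd (line_norm (diag_sum G))" "odd (line_norm (antidiag_sum G))"
    using odd by (simp_all add: G_def line_norms_shift)
  moreover have "line_norm (row_sum G) dvd det33 G" "line_norm (col_sum G) dvd det33 G"
    "line_norm (diag_sum G) dvd det33 G" "line_norm (antidiag_sum G) dvd det33 G"
    by (simp_all add: det33_def)
  ultimately have
    "odd (row_sum F 0 - row_sum F 2) \<and> even (slope (row_sum F))"
    "odd (col_sum F 0 - col_sum F 2) \<and> even (slope (col_sum F))"
    "odd (diag_sum F 0 - diag_sum F 2) \<and> even (slope (diag_sum F))"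
    "odd (antidiag_sum F 0 - antidiag_sum F 2) \<and> even (slope (antidiag_sum F))"
    using cls[of "row_sum G" "row_sum F"] cls[of "col_sum G" "col_sum F"] cls[of "diag_sum G" "diag_sum F"]
      cls[of "antidiag_sum G" "antidiag_sum F"] hk line_sums[of G] same_parity_line_sums[OF par]
    unfolding G_def[symmetric] by blast+
  moreover have "3 dvd total_sum F" using assms(2) by (simp add: F_def total_sum_shift)
  moreover have "type1_free (det33 F)"
    using free by (rule type1_free_dvd) (simp add: F_def det33_shift)
  ultimately have "\<not> exactly_divides 3 7 (det33 F)"
    using type1_free_det33_valuation by blast
  with assms(4) show False by (simp add: F_def det33_shift)
qed

section \<open>The determinants with 3-adic valuation 7\<close>

text \<open>At the four pairs of characters the element built here for the factor \<open>3 ^ 7 * n * N(\<xi>)\<close>,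
  \<open>\<xi> = x + y\<omega>\<close>, takes the values \<open>\<theta>\<xi>\<close>, \<open>-3\<close>, \<open>\<theta>\<close>, \<open>\<theta>\<close> with
  \<open>\<theta> = 1 + 2\<omega>\<close> of norm 3, and the one for \<open>b * N(\<beta>)\<close>, \<open>\<beta> = u + v\<omega>\<close>,
  takes the values \<open>\<beta>\<close>, 1, 1, 1.\<close>

lemma mem_S_Z3_Z6I:
  assumes mod3: "[x = 0] (mod 3)" "[y = 1] (mod 3)" "[u = 1] (mod 3)" "[v = 0] (mod 3)"
    and mod9: "[b = u + v] (mod 9)"
    and parity: "even (n - b)" "even (x - u)" "even (y - v)"
  shows "3 ^ 7 * n * eisenstein_norm x y * (b * eisenstein_norm u v) \<in> S_Z3_Z6"
proof -
  obtain x' y' u' v' where xyuv: "x = 3 * x'" "y = 1 + 3 * y'" "u = 1 + 3 * u'" "v = 3 * v'"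
    using mod3 by (metis cong_iff_lin cong_sym add_0 mult.commute)
  obtain k where b: "b = u + v + 9 * k"
    using mod9 by (metis cong_iff_lin cong_sym mult.commute)
  \<comment> \<open>\<open>n\<close> enters only the total. The second summand depends on the row
    alone and sums to 0, so it adjusts only the row value. The third has total 0 and realises the
    case \<open>x' = y' = 0\<close>, that is \<xi> = \<omega>.\<close>
  define f :: "3 \<Rightarrow> 3 \<Rightarrow> int" where
    "f i j = n + (if i = 0 then - y' else if i = 1 then x' else y' - x') +
      (if i = 1 then 0 else if j = 0 then - 1 else if i = 0 then 0 else 1)" for i j
  \<comment> \<open>The point mass at the origin has value 1 in every direction; the row term moves
    the row value to \<beta>, and \<open>k\<close> corrects the total by 9k.\<close>
  define g :: "3 \<Rightarrow> 3 \<Rightarrow> int" where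
    "g i j = k + (if i = 0 then u' else if i = 1 then v' else 0) +
      (if i = 0 \<and> j = 0 then 1 else 0)" for i j
  have "total_sum f = 9 * n" "line_norm (row_sum f) = 3 * eisenstein_norm x y" "line_norm (col_sum f) = 9"
    "line_norm (diag_sum f) = 3" "line_norm (antidiag_sum f) = 3"
    by (simp_all add: f_def line_norm_def line_sum_simps eisenstein_norm_def power2_eq_square
        algebra_simps xyuv)
  then have "det33 f = 3 ^ 7 * n * eisenstein_norm x y"
    by (simp add: det33_def)
  moreover have "total_sum g = b" "line_norm (row_sum g) = eisenstein_norm u v" "line_norm (col_sum g) = 1"
    "line_norm (diag_sum g) = 1" "line_norm (antidiag_sum g) = 1"
    by (simp_all add: g_def line_norm_def line_sum_simps eisenstein_norm_def power2_eq_square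
        algebra_simps xyuv b)
  then have "det33 g = b * eisenstein_norm u v"
    by (simp add: det33_def)
  moreover have "same_parity f g"
  proof (intro allI)
    fix i j :: 3
    have "even (n - (1 + u' + v' + k))" "even (x' - (1 + u'))" "even (1 + y' - v')"
      using parity unfolding xyuv b by presburger+
    then show "even (f i j - g i j)"
      using exhaust_3_from_0[of i] exhaust_3_from_0[of j]
      by (elim disjE) (simp_all add: f_def g_def, presburger+)
  qed
  ultimately show ?thesis
    unfolding S_Z3_Z6_eq by (intro CollectI exI[of _ f] exI[of _ g]) simp
qed

section \<open>Realising the listed forms\<close>

lemma type1_primeE:
  assumes "type1_prime p"
  obtains A B where "p = eisenstein_norm (2 * (1 + 3 * B)) (3 * (1 + 2 * A))"
    "[p = 7 + 6 * (A + B)] (mod 18)"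
proof -
  obtain A B where p: "p = eisenstein_norm (2 * (1 + 3 * B)) (3 * (1 + 2 * A))"
    using assms by (auto simp: type1_prime_def)
  have "p - (7 + 6 * (A + B)) = 18 * (A + 2 * B\<^sup>2 - 2 * A * B + 2 * A\<^sup>2)"
    unfolding p eisenstein_norm_def power2_eq_square by (simp add: algebra_simps)
  then have "[p = 7 + 6 * (A + B)] (mod 18)"
    unfolding cong_iff_dvd_diff by (rule dvdI)
  with p show ?thesis by (rule that)
qed

lemma type1_prime_mod_18:
  assumes "type1_prime p"
  shows "p mod 18 = 1 \<or> p mod 18 = 7 \<or> p mod 18 = 13"
proof -
  obtain A B where "[p = 7 + 6 * (A + B)] (mod 18)"
    using type1_primeE assms by blast
  moreover have "(7 + 6 * q) mod 18 = 1 \<or> (7 + 6 * q) mod 18 = 7 \<or> (7 + 6 * q) mod 18 = 13"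
    for q :: int
    by presburger
  ultimately show ?thesis unfolding cong_def by metis
qed

lemma type1_coordinates_mod_3: "[- (3 * (1 + 2 * A)) = 0] (mod 3)" "[- (2 * (1 + 3 * B)) = 1] (mod 3)"
  for A B :: int
proof -
  show "[- (3 * (1 + 2 * A)) = 0] (mod 3)"
    by (simp only: cong_0_iff dvd_minus_iff dvd_triv_left)
  have "- (2 * (1 + 3 * B)) - 1 = 3 * (- 1 - 2 * B)" by simp
  then show "[- (2 * (1 + 3 * B)) = 1] (mod 3)"
    unfolding cong_iff_dvd_diff by (rule dvdI)
qed

text \<open>The prime sits in \<xi>, and \<beta> = 1. Swapping the coordinates of the type 1
  representation and changing signs keeps the norm and gives the required residues.\<close>

lemma mem_S_type1:
  assumes "type1_prime p" "[b = 1] (mod 9)" "even (n - b)"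
  shows "3 ^ 7 * n * p * b \<in> S_Z3_Z6"
proof -
  obtain A B where p: "p = eisenstein_norm (2 * (1 + 3 * B)) (3 * (1 + 2 * A))"
    using type1_primeE assms by blast
  have "p = eisenstein_norm (- (3 * (1 + 2 * A))) (- (2 * (1 + 3 * B)))"
    unfolding p eisenstein_norm_uminus by (simp add: eisenstein_norm_def algebra_simps)
  moreover have "3 ^ 7 * n * eisenstein_norm (- (3 * (1 + 2 * A))) (- (2 * (1 + 3 * B))) *
    (b * eisenstein_norm 1 0) \<in> S_Z3_Z6"
    using assms(2,3) by (intro mem_S_Z3_Z6I type1_coordinates_mod_3) simp_all
  ultimately show ?thesis by (simp add: eisenstein_norm_def)
qed

text \<open>The prime sits in \<beta>, and \<xi> = \<omega>. The coordinate sum of \<beta> is -5 -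
  6(A + B), which is 2 - p modulo 9.\<close>

lemma mem_S_type1':
  assumes "type1_prime p" "[b = 2 - p] (mod 9)" "even (n - b)"
  shows "3 ^ 7 * n * (b * p) \<in> S_Z3_Z6"
proof -
  obtain A B where p: "p = eisenstein_norm (2 * (1 + 3 * B)) (3 * (1 + 2 * A))"
    "[p = 7 + 6 * (A + B)] (mod 18)"
    using type1_primeE assms(1) by blast
  have "[p = 7 + 6 * (A + B)] (mod 9)"
    using p(2) by (rule cong_dvd_modulus) simp
  then have "[2 - p = 2 - (7 + 6 * (A + B))] (mod 9)"
    by (intro cong_diff cong_refl)
  then have "[b = - (2 * (1 + 3 * B)) + - (3 * (1 + 2 * A))] (mod 9)"
    using cong_trans[OF assms(2)] by (simp add: algebra_simps)
  then have "3 ^ 7 * n * eisenstein_norm 0 1 *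
    (b * eisenstein_norm (- (2 * (1 + 3 * B))) (- (3 * (1 + 2 * A)))) \<in> S_Z3_Z6"
    using assms(3) by (intro mem_S_Z3_Z6I type1_coordinates_mod_3) (simp_all only:, simp_all)
  moreover have "eisenstein_norm 0 1 = 1" by (simp add: eisenstein_norm_def)
  ultimately show ?thesis by (simp only: eisenstein_norm_uminus p(1) mult_1_right)
qed

text \<open>The choice \<xi> = -2\<omega> and \<beta> = -2, with coordinate sum 7 modulo 9.\<close>

lemma mem_S_norm_2:
  assumes "[b = 7] (mod 9)" "even (n - b)"
  shows "3 ^ 7 * n * 4 * (b * 4) \<in> S_Z3_Z6"
proof -
  have "3 ^ 7 * n * eisenstein_norm 0 (- 2) * (b * eisenstein_norm (- 2) 0) \<in> S_Z3_Z6"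
    using assms by (intro mem_S_Z3_Z6I) (unfold cong_def, presburger+)
  then show ?thesis by (simp add: eisenstein_norm_def)
qed

lemma odd_type1_mem_S:
  assumes "type1_prime p"
  shows "3 ^ 7 * (2 * m + 1) * p \<in> S_Z3_Z6"
  using mem_S_type1[OF assms, of 1 "2 * m + 1"] by (simp add: cong_def)

lemma form1_mem_S: "form1 D \<Longrightarrow> D \<in> S_Z3_Z6"
proof -
  assume "form1 D"
  then obtain m where "D = 3 ^ 7 * 2 ^ 6 * m" by (auto simp: form1_def)
  then show ?thesis
    using mem_S_norm_2[of "- 2" "- 2 * m"] by (simp add: cong_def)
qed

lemma form2_mem_S: "form2 D \<Longrightarrow> D \<in> S_Z3_Z6"
proof -
  assume "form2 D"
  then obtain m k where D: "D = 3 ^ 7 * 2 ^ 4 * (2 * m + 1) * (7 + 18 * k)" by (auto simp: form2_def)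
  have "[7 + 18 * k = 7] (mod 9)" by (simp add: cong_iff_dvd_diff)
  then have "3 ^ 7 * (2 * m + 1) * 4 * ((7 + 18 * k) * 4) \<in> S_Z3_Z6"
    by (rule mem_S_norm_2) simp
  moreover have "3 ^ 7 * (2 * m + 1) * 4 * ((7 + 18 * k) * 4) = D" unfolding D by algebra
  ultimately show ?thesis by simp
qed

lemma form3_mem_S: "form3 D \<Longrightarrow> D \<in> S_Z3_Z6"
proof -
  assume "form3 D"
  then obtain m k p where p: "type1_prime p" and D: "D = 3 ^ 7 * 2\<^sup>2 * m * (4 + 9 * k) * p"
    by (auto simp: form3_def)
  have "[- 2 * (4 + 9 * k) = 1] (mod 9)" unfolding cong_def by presburger
  then have "3 ^ 7 * (- 2 * m) * p * (- 2 * (4 + 9 * k)) \<in> S_Z3_Z6"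
    by (intro mem_S_type1 p) simp_all
  moreover have "3 ^ 7 * (- 2 * m) * p * (- 2 * (4 + 9 * k)) = D" unfolding D by algebra
  ultimately show ?thesis by simp
qed

lemma form4_mem_S: "form4 D \<Longrightarrow> D \<in> S_Z3_Z6"
proof -
  assume "form4 D"
  then obtain m k p where p: "type1_prime p" "[p = 7] (mod 18)"
    and D: "D = 3 ^ 7 * 2\<^sup>2 * m * (2 + 9 * k) * p"
    by (auto simp: form4_def)
  obtain j where j: "p - 7 = 18 * j"
    using p(2) unfolding cong_iff_dvd_diff by blast
  have "2 * (2 + 9 * k) - (2 - p) = 9 * (1 + 2 * k + 2 * j)" using j by simp
  then have "[2 * (2 + 9 * k) = 2 - p] (mod 9)"
    unfolding cong_iff_dvd_diff by (rule dvdI)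
  then have "3 ^ 7 * (2 * m) * (2 * (2 + 9 * k) * p) \<in> S_Z3_Z6"
    by (intro mem_S_type1' p(1)) simp_all
  moreover have "3 ^ 7 * (2 * m) * (2 * (2 + 9 * k) * p) = D" unfolding D by algebra
  ultimately show ?thesis by simp
qed

lemma form5_mem_S: "form5 D \<Longrightarrow> D \<in> S_Z3_Z6"
proof -
  assume "form5 D"
  then obtain m p where p: "type1_prime p" "[p = 13] (mod 18)" and D: "D = 3 ^ 7 * 2\<^sup>2 * m * p"
    by (auto simp: form5_def)
  obtain j where j: "p - 13 = 18 * j"
    using p(2) unfolding cong_iff_dvd_diff by blast
  have "- 2 - (2 - p) = 9 * (1 + 2 * j)" using j by simp
  then have "[- 2 = 2 - p] (mod 9)"
    unfolding cong_iff_dvd_diff by (rule dvdI)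
  then have "3 ^ 7 * (- 2 * m) * (- 2 * p) \<in> S_Z3_Z6"
    by (intro mem_S_type1' p(1)) simp_all
  moreover have "3 ^ 7 * (- 2 * m) * (- 2 * p) = D" unfolding D by algebra
  ultimately show ?thesis by simp
qed

section \<open>Necessity of the listed forms\<close>

lemma exactly_divides_S_cases:
  assumes "D \<in> S_Z3_Z6" "exactly_divides 3 7 D"
  obtains f g where "D = det33 f * det33 g" "same_parity f g" "3 dvd total_sum f" "\<not> 3 dvd total_sum g"
    "exactly_divides 3 7 (det33 f)"
proof -
  note result = that
  \<comment> \<open>By symmetry the factor divisible by 3 may be called \<open>f\<close>. The other
    one is prime to 3, since each factor divisible by 3 contributes 3^5.\<close>
  have wlog: thesis
    if fg: "D = det33 f * det33 g" "same_parity f g" "3 dvd total_sum f" for f g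
  proof -
    have "\<not> 3 dvd total_sum g"
    proof
      assume "3 dvd total_sum g"
      then have "3 ^ 5 * 3 ^ 5 dvd D"
        unfolding fg(1) by (intro mult_dvd_mono det33_dvd_if_three_dvd_total fg(3))
      then have "3 ^ 8 dvd D" by (rule dvd_trans[rotated]) simp
      with assms(2) show False by (simp add: exactly_divides_def)
    qed
    moreover from this have "coprime (3 ^ n) (det33 g)" for n
      by (simp add: prime_imp_coprime three_dvd_det33)
    then have "exactly_divides 3 7 (det33 f)"
      using assms(2) unfolding exactly_divides_def fg(1) by (metis coprime_dvd_mult_left_iff)
    ultimately show thesis using result fg by blast
  qed
  obtain f g where fg: "D = det33 f * det33 g" "same_parity f g"
    using assms(1) unfolding S_Z3_Z6_eq by blast
  have "3 dvd D"
    using assms(2) unfolding exactly_divides_def by (metis dvd_power dvd_trans zero_less_numeral)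
  then have "3 dvd total_sum f \<or> 3 dvd total_sum g"
    unfolding fg(1) by (simp add: prime_dvd_mult_iff three_dvd_det33)
  moreover have "same_parity g f" using fg(2) by (simp add: dvd_diff_commute)
  ultimately show thesis
    using wlog fg by (metis mult.commute)
qed

lemma exactly_dividesE:
  assumes "exactly_divides 3 7 D" "k dvd D" "coprime 3 k"
  obtains m where "D = 3 ^ 7 * k * m"
proof -
  have "coprime (3 ^ 7) k"
    using assms(3) by (simp only: coprime_power_left_iff simp_thms)
  then have "3 ^ 7 * k dvd D"
    using assms by (intro divides_mult) (simp_all add: exactly_divides_def)
  then show ?thesis using that by blast
qed

lemma type1_prime_coprime_6:
  assumes "type1_prime p"
  shows "coprime 3 p" "coprime 2 p"
  using type1_prime_mod_18[OF assms]
  by (auto intro!: prime_imp_coprime) presburger+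

lemma odd_necessary:
  assumes "D \<in> S_Z3_Z6" "exactly_divides 3 7 D" "odd D"
  shows "\<exists>m p. type1_prime p \<and> D = 3 ^ 7 * (2 * m + 1) * p"
proof -
  obtain f g where fg: "D = det33 f * det33 g" "same_parity f g" "3 dvd total_sum f" "\<not> 3 dvd total_sum g"
    "exactly_divides 3 7 (det33 f)"
    using exactly_divides_S_cases assms by blast
  have "odd (det33 g)" using assms(3) fg(1) by simp
  then obtain p where p: "type1_prime p" "p dvd D"
    using type1_prime_dvd_det33[OF fg(2-5)] fg(1) by (auto simp: det33_def)
  then obtain e where e: "D = 3 ^ 7 * p * e"
    using exactly_dividesE assms(2) type1_prime_coprime_6 by metis
  then have "odd e" using assms(3) by simp
  then obtain m where "e = 2 * m + 1" by (rule oddE)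
  with e p show ?thesis by (auto simp: mult_ac)
qed

text \<open>The prime 2 is inert: an even norm has both coordinates even, so 2 splits off only in
  pairs.\<close>

lemma eisenstein_norm_four_power:
  assumes "eisenstein_norm x y \<noteq> 0"
  shows "\<exists>j r. eisenstein_norm x y = 4 ^ j * r \<and> odd r"
  using assms
proof (induction "nat (eisenstein_norm x y)" arbitrary: x y rule: less_induct)
  case less
  show ?case
  proof (cases "odd (eisenstein_norm x y)")
    case True
    then show ?thesis by (intro exI[of _ 0] exI[of _ "eisenstein_norm x y"]) simp
  next
    case False
    then have "even x" "even y" by (simp_all add: odd_eisenstein_norm)
    then obtain x' y' where "x = 2 * x'" "y = 2 * y'" by (auto elim!: evenE)
    then have eq: "eisenstein_norm x y = 4 * eisenstein_norm x' y'"
      by (simp add: eisenstein_norm_scale)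
    then have "nat (eisenstein_norm x' y') < nat (eisenstein_norm x y)"
      using eisenstein_norm_nonneg[of x' y'] less.prems by simp
    with less.hyps[of x' y'] less.prems eq obtain j r where
      "eisenstein_norm x' y' = 4 ^ j * r" "odd r" by auto
    with eq show ?thesis by (intro exI[of _ "Suc j"] exI[of _ r]) simp
  qed
qed

definition norm_product :: "(3 \<Rightarrow> 3 \<Rightarrow> int) \<Rightarrow> int" where
  "norm_product f = line_norm (row_sum f) * line_norm (col_sum f) * line_norm (diag_sum f) * line_norm (antidiag_sum f)"

lemma det33_eq_norm_product: "det33 f = total_sum f * norm_product f"
  by (simp add: det33_def norm_product_def)

lemma norm_product_four_power:
  assumes "norm_product f \<noteq> 0"
  shows "\<exists>j r. norm_product f = 4 ^ j * r \<and> odd r"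
proof -
  have mult: "\<exists>j r. a * b = 4 ^ j * r \<and> odd r"
    if "\<exists>j r. a = 4 ^ j * r \<and> odd r" "\<exists>j r. b = 4 ^ j * r \<and> odd r" for a b :: int
  proof -
    from that obtain j r k s where "a = 4 ^ j * r" "odd r" "b = 4 ^ k * s" "odd s"
      by (elim exE conjE)
    then show ?thesis by (intro exI[of _ "j + k"] exI[of _ "r * s"]) (simp add: power_add)
  qed
  show ?thesis
    using assms unfolding norm_product_def line_norm_def
    by (intro mult eisenstein_norm_four_power) auto
qed

lemma norm_product_cases:
  assumes "norm_product f \<noteq> 0"
  obtains "odd (norm_product f)" | r where "norm_product f = 4 * r" "odd r" | "16 dvd norm_product f"
proof -
  obtain j r where jr: "norm_product f = 4 ^ j * r" "odd r"
    using norm_product_four_power assms by blast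
  consider "j = 0" | "j = 1" | i where "j = Suc (Suc i)" by (metis One_nat_def old.nat.exhaust)
  then show ?thesis
    using that jr by cases (auto simp: mult.assoc)
qed

lemma even_norm_product:
  assumes "norm_product f \<noteq> 0" "even (norm_product f)"
  shows "4 dvd norm_product f"
  using norm_product_cases[OF assms(1)]
proof cases
  case 3
  then show ?thesis by (rule dvd_trans[rotated]) simp
qed (use assms(2) in auto)

lemma same_parity_norm_product:
  assumes "same_parity f g"
  shows "even (norm_product f) \<longleftrightarrow> even (norm_product g)"
  using same_parity_line_sums[OF assms]
  by (simp add: norm_product_def same_parity_even_line_norm[of "row_sum f" "row_sum g"]
      same_parity_even_line_norm[of "col_sum f" "col_sum g"]
      same_parity_even_line_norm[of "diag_sum f" "diag_sum g"]
      same_parity_even_line_norm[of "antidiag_sum f" "antidiag_sum g"])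

lemma form1I:
  assumes "exactly_divides 3 7 D" "2 ^ 6 dvd D"
  shows "form1 D"
proof -
  have "coprime 3 (2 ^ 6 :: int)"
    by (simp add: prime_imp_coprime)
  then show ?thesis
    using exactly_dividesE assms unfolding form1_def by metis
qed

text \<open>\<open>v\<close> is the inverse of \<open>u\<close>. This isolates a cofactor of
  \<open>det33 g\<close>, which \<open>det33_mod_9\<close> determines only up to sign.\<close>

lemma cong_unit_cancel_up_to_sign:
  fixes c :: int
  assumes "[v * u = 1] (mod n)" "[v * a = r] (mod n)" "[u * c = a] (mod n) \<or> [u * c = - a] (mod n)"
  shows "[c = r] (mod n) \<or> [- c = r] (mod n)"
proof -
  have cancel: "[c = r] (mod n)" if "[u * c = a] (mod n)" for c
  proof -
    have "[v * u * c = 1 * c] (mod n)" using assms(1) by (rule cong_scalar_right)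
    moreover have "[v * (u * c) = v * a] (mod n)" using that by (rule cong_scalar_left)
    ultimately show ?thesis
      using assms(2) by (metis cong_sym cong_trans mult.assoc mult_1)
  qed
  have "[u * (- c) = a] (mod n)" if "[u * c = - a] (mod n)"
    using cong_minus_minus_iff[of "u * c" "- a" n] that by simp
  then show ?thesis
    using assms(3) cancel by blast
qed

lemma cong_int_obtain:
  fixes c :: int
  assumes "[c = r] (mod n)"
  obtains k where "c = r + n * k"
proof -
  obtain k where "c - r = n * k" using assms unfolding cong_iff_dvd_diff by blast
  then show ?thesis by (intro that[of k]) simp
qed

lemma form2I:
  assumes "D = 3 ^ 7 * 2 ^ 4 * e * c" "odd e" "odd c" "[c = 7] (mod 9) \<or> [- c = 7] (mod 9)"
  shows "form2 D"
proof -
  have form2: "form2 D"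
    if "D = 3 ^ 7 * 2 ^ 4 * e * c" "odd e" "odd c" "[c = 7] (mod 9)" for e c
  proof -
    from that(4) obtain k where k: "c = 7 + 9 * k" by (rule cong_int_obtain)
    with that(3) have "even k" by simp
    then obtain l where "k = 2 * l" by (rule evenE)
    with k have "c = 7 + 18 * l" by simp
    moreover from that(2) obtain m where "e = 2 * m + 1" by (rule oddE)
    ultimately show ?thesis unfolding form2_def using that(1) by blast
  qed
  from assms(4) show ?thesis
    using form2[of e c] form2[of "- e" "- c"] assms(1-3) by (elim disjE) simp_all
qed

lemma form3I:
  assumes "type1_prime p" "D = 3 ^ 7 * 2\<^sup>2 * m * d * p" "[d = 4] (mod 9) \<or> [- d = 4] (mod 9)"
  shows "form3 D"
proof -
  have form3: "form3 D" if "D = 3 ^ 7 * 2\<^sup>2 * m * d * p" "[d = 4] (mod 9)" for m d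
    using cong_int_obtain[OF that(2)] that(1) assms(1) unfolding form3_def by metis
  from assms(3) show ?thesis
    using form3[of m d] form3[of "- m" "- d"] assms(2) by (elim disjE) simp_all
qed

lemma form4I:
  assumes "type1_prime p" "[p = 7] (mod 18)" "D = 3 ^ 7 * 2\<^sup>2 * m * d * p"
    "[d = 2] (mod 9) \<or> [- d = 2] (mod 9)"
  shows "form4 D"
proof -
  have form4: "form4 D" if "D = 3 ^ 7 * 2\<^sup>2 * m * d * p" "[d = 2] (mod 9)" for m d
    using cong_int_obtain[OF that(2)] that(1) assms(1,2) unfolding form4_def by metis
  from assms(4) show ?thesis
    using form4[of m d] form4[of "- m" "- d"] assms(3) by (elim disjE) simp_all
qed

lemma three_power_dvd_cofactor:
  assumes "exactly_divides 3 7 (k * x)" "coprime 3 k"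
  obtains e where "x = 3 ^ 7 * e"
proof -
  have "3 ^ 7 dvd k * x" using assms(1) by (simp add: exactly_divides_def)
  moreover have "coprime (3 ^ 7) k" using assms(2) by (simp only: coprime_power_left_iff simp_thms)
  ultimately have "3 ^ 7 dvd x" by (simp only: coprime_dvd_mult_right_iff)
  then show ?thesis using that by blast
qed

text \<open>Odd totals leave all factors 2 to the norm products. Both are even, and each has exactly
  the factor 4 because 64 does not divide \<open>D\<close>; the cofactor of 4 in
  \<open>det33 g\<close> is then 7 modulo 9 up to sign.\<close>

lemma form2_of_odd_total:
  assumes fg: "D = det33 f * det33 g" "same_parity f g" "3 dvd total_sum f" "\<not> 3 dvd total_sum g"
    "exactly_divides 3 7 (det33 f)"
    and "even D" "D \<noteq> 0" "\<not> 2 ^ 6 dvd D" "odd (total_sum f)"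
  shows "form2 D"
proof -
  have D: "D = total_sum f * norm_product f * (total_sum g * norm_product g)"
    by (simp add: fg(1) det33_eq_norm_product)
  have not64: "\<not> 64 dvd D" using assms(8) by simp
  have nz: "norm_product f \<noteq> 0" "norm_product g \<noteq> 0" using \<open>D \<noteq> 0\<close> by (auto simp: D)
  have par: "even (total_sum f) \<longleftrightarrow> even (total_sum g)" "even (norm_product f) \<longleftrightarrow> even (norm_product g)"
    using same_parity_line_sums(5)[OF fg(2)] same_parity_norm_product[OF fg(2)] by simp_all
  have mod9: "[det33 g = 1] (mod 9) \<or> [det33 g = - 1] (mod 9)"
    using det33_mod_9 fg(4) by blast
  have "even (norm_product f)" "even (norm_product g)"
    using assms(6,9) par by (auto simp: D)
  then have four: "4 dvd norm_product f" "4 dvd norm_product g"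
    using even_norm_product nz by blast+
  have not16: "\<not> 16 dvd norm_product f" "\<not> 16 dvd norm_product g"
  proof -
    have D': "D = total_sum f * total_sum g * (norm_product f * norm_product g)"
      by (simp add: D)
    show "\<not> 16 dvd norm_product f"
      using mult_dvd_mono[of 16 "norm_product f" 4 "norm_product g"] four(2) not64 D' by auto
    show "\<not> 16 dvd norm_product g"
      using mult_dvd_mono[of 4 "norm_product f" 16 "norm_product g"] four(1) not64 D' by auto
  qed
  obtain r where r: "norm_product f = 4 * r" "odd r"
    using not16(1) four(1) by (cases rule: norm_product_cases[OF nz(1)]) auto
  obtain s where "norm_product g = 4 * s" "odd s"
    using not16(2) four(2) by (cases rule: norm_product_cases[OF nz(2)]) auto
  note rs = r this
  obtain e where e: "total_sum f * r = 3 ^ 7 * e"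
  proof (rule three_power_dvd_cofactor)
    show "exactly_divides 3 7 (4 * (total_sum f * r))"
      using fg(5) by (simp add: det33_eq_norm_product rs mult_ac)
    show "coprime 3 (4 :: int)" by (simp add: prime_imp_coprime)
  qed
  have "odd (total_sum f * r)" using assms(9) rs by simp
  then have "odd e" unfolding e by simp
  define c where "c = total_sum g * s"
  have "odd c" using assms(9) par rs by (simp add: c_def)
  have D_eq: "D = 3 ^ 7 * 2 ^ 4 * e * c"
  proof -
    have "D = 16 * (total_sum f * r) * c" by (simp add: D rs c_def)
    then show ?thesis unfolding e by simp
  qed
  have "det33 g = 4 * c" by (simp add: det33_eq_norm_product rs c_def)
  with mod9 have "[4 * c = 1] (mod 9) \<or> [4 * c = - 1] (mod 9)" by simp
  then have "[c = 7] (mod 9) \<or> [- c = 7] (mod 9)"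
    by (rule cong_unit_cancel_up_to_sign[of 7, rotated 2]) (simp_all add: cong_def)
  then show ?thesis
    using form2I[OF D_eq \<open>odd e\<close> \<open>odd c\<close>] by blast
qed

text \<open>Even totals together with even norm products would give 2^6. So the norms are odd, a
  type 1 prime divides \<open>D\<close>, and half of \<open>det33 g\<close> is 4 modulo 9 up to
  sign. The form depends on which factor the prime divides.\<close>

lemma form345_of_even_total:
  assumes fg: "D = det33 f * det33 g" "same_parity f g" "3 dvd total_sum f" "\<not> 3 dvd total_sum g"
    "exactly_divides 3 7 (det33 f)"
    and "even D" "D \<noteq> 0" "\<not> 2 ^ 6 dvd D" "even (total_sum f)"
  shows "form3 D \<or> form4 D \<or> form5 D"
proof -
  have D: "D = total_sum f * norm_product f * (total_sum g * norm_product g)"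
    by (simp add: fg(1) det33_eq_norm_product)
  have not64: "\<not> 64 dvd D" using assms(8) by simp
  have nz: "norm_product f \<noteq> 0" "norm_product g \<noteq> 0" using \<open>D \<noteq> 0\<close> by (auto simp: D)
  have par: "even (total_sum f) \<longleftrightarrow> even (total_sum g)" "even (norm_product f) \<longleftrightarrow> even (norm_product g)"
    using same_parity_line_sums(5)[OF fg(2)] same_parity_norm_product[OF fg(2)] by simp_all
  have mod9: "[det33 g = 1] (mod 9) \<or> [det33 g = - 1] (mod 9)"
    using det33_mod_9 fg(4) by blast
  obtain a b where ab: "total_sum f = 2 * a" "total_sum g = 2 * b" using assms(9) par by (auto elim!: evenE)
  have "odd (norm_product g)"
  proof
    assume "even (norm_product g)"
    then have "2 * 4 * (2 * 4) dvd D"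
      unfolding D using assms(9) par nz even_norm_product by (intro mult_dvd_mono) auto
    with not64 show False by simp
  qed
  then obtain p where p: "type1_prime p" "p dvd D"
    using type1_prime_dvd_det33[OF fg(2-5)] fg(1) by (auto simp: norm_product_def)
  define c where "c = b * norm_product g"
  obtain e where e: "a * norm_product f = 3 ^ 7 * e"
  proof (rule three_power_dvd_cofactor)
    show "exactly_divides 3 7 (2 * (a * norm_product f))"
      using fg(5) by (simp add: det33_eq_norm_product ab mult_ac)
    show "coprime 3 (2 :: int)" by (simp add: prime_imp_coprime)
  qed
  have D_eq: "D = 3 ^ 7 * 2\<^sup>2 * e * c"
  proof -
    have "D = 4 * (a * norm_product f) * c" by (simp add: D ab c_def)
    then show ?thesis unfolding e by simp
  qed
  have "det33 g = 2 * c" by (simp add: det33_eq_norm_product ab c_def)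
  with mod9 have "[2 * c = - 1] (mod 9) \<or> [2 * c = - (- 1)] (mod 9)" by auto
  then have c: "[c = 4] (mod 9) \<or> [- c = 4] (mod 9)"
    by (rule cong_unit_cancel_up_to_sign[of "- 4", rotated 2]) (simp_all add: cong_def)
  have "p dvd e \<or> p dvd c"
  proof -
    have "prime p" using p(1) by (simp add: type1_prime_def)
    moreover have "coprime p (3 ^ 7 * 2\<^sup>2)"
      using type1_prime_coprime_6[OF p(1)]
      by (simp only: coprime_mult_right_iff coprime_power_right_iff coprime_commute[of p] simp_thms)
    moreover have "p dvd 3 ^ 7 * 2\<^sup>2 * (e * c)" using p(2) D_eq by (simp add: mult.assoc)
    ultimately show ?thesis by (simp only: coprime_dvd_mult_right_iff prime_dvd_mult_iff)
  qed
  then show ?thesis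
  proof
    assume "p dvd e"
    then obtain m where "e = p * m" by blast
    then have "form3 D" using form3I[OF p(1), of D m c] c D_eq by simp
    then show ?thesis by blast
  next
    assume "p dvd c"
    then obtain d where d: "c = p * d" by blast
    \<comment> \<open>The residue of \<open>p\<close> decides \<open>d\<close> up to sign modulo 9:
      residue 1 gives 4 and residue 7 gives 2. For 13, \<open>d\<close> is absorbed into the free
      multiplier of \<open>form5\<close>.\<close>
    have pd: "[r * d = 4] (mod 9) \<or> [r * d = - 4] (mod 9)" if "p mod 18 = r" for r
    proof -
      have "[p = r] (mod 18)" using that by (auto simp: cong_def)
      then have "[p = r] (mod 9)" by (rule cong_dvd_modulus) simp
      then have "[c = r * d] (mod 9)" unfolding d by (rule cong_scalar_right)
      moreover have "[c = 4] (mod 9) \<or> [c = - 4] (mod 9)"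
        using c cong_minus_minus_iff[of c "- 4" 9] by simp
      ultimately show ?thesis using cong_sym cong_trans by blast
    qed
    from type1_prime_mod_18[OF p(1)] show ?thesis
    proof (elim disjE)
      assume "p mod 18 = 1"
      then have "[1 * d = 4] (mod 9) \<or> [1 * d = - 4] (mod 9)" by (rule pd)
      then have "[d = 4] (mod 9) \<or> [- d = 4] (mod 9)"
        by (rule cong_unit_cancel_up_to_sign[of 1, rotated 2]) simp_all
      then have "form3 D" using form3I[OF p(1), of D e d] D_eq d by simp
      then show ?thesis by blast
    next
      assume p7: "p mod 18 = 7"
      then have p7': "[p = 7] (mod 18)" by (simp add: cong_def)
      from p7 have "[7 * d = 4] (mod 9) \<or> [7 * d = - 4] (mod 9)" by (rule pd)
      then have "[7 * d = - 4] (mod 9) \<or> [7 * d = - (- 4)] (mod 9)" by auto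
      then have "[d = 2] (mod 9) \<or> [- d = 2] (mod 9)"
        by (rule cong_unit_cancel_up_to_sign[of 4, rotated 2]) (simp_all add: cong_def)
      then have "form4 D" using form4I[OF p(1) p7', of D e d] D_eq d by simp
      then show ?thesis by blast
    next
      assume "p mod 18 = 13"
      then have "[p = 13] (mod 18)" by (simp add: cong_def)
      moreover have "D = 3 ^ 7 * 2\<^sup>2 * (e * d) * p" using D_eq d by simp
      ultimately have "form5 D" unfolding form5_def using p(1) by blast
      then show ?thesis by blast
    qed
  qed
qed

lemma even_necessary:
  assumes "D \<in> S_Z3_Z6" "exactly_divides 3 7 D" "even D"
  shows "form1 D \<or> form2 D \<or> form3 D \<or> form4 D \<or> form5 D"
proof -
  obtain f g where fg: "D = det33 f * det33 g" "same_parity f g" "3 dvd total_sum f" "\<not> 3 dvd total_sum g"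
    "exactly_divides 3 7 (det33 f)"
    using exactly_divides_S_cases assms by blast
  have "D \<noteq> 0" using assms(2) by (auto simp: exactly_divides_def)
  then show ?thesis
    using form1I[OF assms(2)] form2_of_odd_total[OF fg assms(3)] form345_of_even_total[OF fg assms(3)]
    by blast
qed

theorem theorem2:
  shows "{D \<in> S_Z3_Z6. odd D \<and> exactly_divides 3 7 D} =
           {D. exactly_divides 3 7 D \<and> (\<exists>m p. type1_prime p \<and> D = 3 ^ 7 * (2 * m + 1) * p)} \<and>
         {D \<in> S_Z3_Z6. even D \<and> exactly_divides 3 7 D} =
           {D. even D \<and> exactly_divides 3 7 D \<and>
               (form1 D \<or> form2 D \<or> form3 D \<or> form4 D \<or> form5 D)} \<and>
         (\<forall>D. even D \<and> exactly_divides 3 7 D \<and> 2 ^ 6 dvd D \<longrightarrow> D \<in> S_Z3_Z6) \<and>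
         (\<forall>D\<in>S_Z3_Z6. even D \<and> exactly_divides 3 7 D \<and> \<not> form1 D \<and> \<not> form2 D \<longrightarrow>
           (\<exists>p. type1_prime p \<and> p dvd D))"
proof (intro conjI allI ballI impI)
  show "{D \<in> S_Z3_Z6. odd D \<and> exactly_divides 3 7 D} =
    {D. exactly_divides 3 7 D \<and> (\<exists>m p. type1_prime p \<and> D = 3 ^ 7 * (2 * m + 1) * p)}"
  proof (intro set_eqI iffI CollectI)
    fix D
    assume "D \<in> {D \<in> S_Z3_Z6. odd D \<and> exactly_divides 3 7 D}"
    then show "exactly_divides 3 7 D \<and> (\<exists>m p. type1_prime p \<and> D = 3 ^ 7 * (2 * m + 1) * p)"
      using odd_necessary by blast
  next
    fix D
    assume "D \<in> {D. exactly_divides 3 7 D \<and> (\<exists>m p. type1_prime p \<and> D = 3 ^ 7 * (2 * m + 1) * p)}"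
    then obtain m p where *: "exactly_divides 3 7 D" "type1_prime p" "D = 3 ^ 7 * (2 * m + 1) * p"
      by blast
    moreover have "odd p" using type1_prime_coprime_6(2)[OF *(2)] by simp
    ultimately show "D \<in> S_Z3_Z6 \<and> odd D \<and> exactly_divides 3 7 D"
      using odd_type1_mem_S[OF *(2)] by simp
  qed
next
  show "{D \<in> S_Z3_Z6. even D \<and> exactly_divides 3 7 D} =
    {D. even D \<and> exactly_divides 3 7 D \<and> (form1 D \<or> form2 D \<or> form3 D \<or> form4 D \<or> form5 D)}"
    using even_necessary form1_mem_S form2_mem_S form3_mem_S form4_mem_S form5_mem_S by blast
next
  fix D :: int
  assume "even D \<and> exactly_divides 3 7 D \<and> 2 ^ 6 dvd D"
  then show "D \<in> S_Z3_Z6"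
    using form1I form1_mem_S by blast
next
  fix D
  assume "D \<in> S_Z3_Z6" "even D \<and> exactly_divides 3 7 D \<and> \<not> form1 D \<and> \<not> form2 D"
  then have "form3 D \<or> form4 D \<or> form5 D"
    using even_necessary by blast
  then show "\<exists>p. type1_prime p \<and> p dvd D"
    by (auto simp: form3_def form4_def form5_def)
qed

end
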